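(* Let $G$ be a locally compact Abelian group with Haar measure $\lambda_G$, and let $\Omega\subset G$ be a closed neighbourhood of $0$ with $\lambda_G(\Omega)<\infty$. Then there exists $f\in\mathcal{G}_G(\Omega)$ with $\int_G f\,d\lambda_G=\mathcal{D}_G(\Omega)$ (an extremal function for $\mathcal{D}_G(\Omega)$). Moreover, there is a sequence $(f_n)_{n\in\mathbb{N}}$ in $\mathcal{G}_G(\Omega)$ with $\int_G f_n\,d\lambda_G\to\mathcal{D}_G(\Omega)$ that converges to $f$ uniformly on the compact subsets of $G$.
   Context: All locally compact Abelian groups are Hausdorff, with identity $0$. A function $f:G\to\mathbb{C}$ is positive definite if $\sum_{i,j=1}^n c_i\overline{c_j} f(g_i-g_j)\ge 0$ for all $n\in\mathbb{N}$, $c_i\in\mathbb{C}$, $g_i\in G$. $P_1(G)$ denotes the set of continuous positive definite functions $f:G\to\mathbb{R}$ with $f(0)=1$. For $f:G\to\mathbb{R}$, $f_+(g):=\max\{f(g),0\}$ and $\operatorname{supp} f:=\overline{\{g: f(g)\neq 0\}}$. Define $\mathcal{G}_G(\Omega):=\{f\in P_1(G)\cap L^1(G): \operatorname{supp} f_+\subset\Omega\}$ and $\mathcal{D}_G(\Omega):=\sup_{f\in\mathcal{G}_G(\Omega)}\int_G f\,d\lambda_G$. *)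

theory Defs
  imports "HOL-Analysis.Analysis"
begin

definition lca_group :: "'a::{ab_group_add, t2_space} itself \<Rightarrow> bool" where
  "lca_group _ \<longleftrightarrow>
     continuous_on UNIV (\<lambda>p::'a \<times> 'a. fst p + snd p) \<and>
     continuous_on UNIV (uminus :: 'a \<Rightarrow> 'a) \<and>
     (\<forall>x::'a. \<exists>U K. open U \<and> compact K \<and> x \<in> U \<and> U \<subseteq> K)"

definition haar_measure :: "'a::{ab_group_add, t2_space} measure \<Rightarrow> bool" where
  "haar_measure M \<longleftrightarrow>
     sets M = sets borel \<and>
     emeasure M UNIV \<noteq> 0 \<and>
     (\<forall>A\<in>sets borel. \<forall>g. emeasure M ((\<lambda>x. g + x) ` A) = emeasure M A) \<and>
     (\<forall>K. compact K \<longrightarrow> emeasure M K < \<infinity>) \<and>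
     (\<forall>A\<in>sets borel. emeasure M A = (INF U\<in>{U. open U \<and> A \<subseteq> U}. emeasure M U)) \<and>
     (\<forall>U. open U \<longrightarrow> emeasure M U = (SUP K\<in>{K. compact K \<and> K \<subseteq> U}. emeasure M K))"

definition positive_definite :: "('a::ab_group_add \<Rightarrow> real) \<Rightarrow> bool" where
  "positive_definite f \<longleftrightarrow>
     (\<forall>(n::nat) (c::nat \<Rightarrow> complex) (g::nat \<Rightarrow> 'a).
        let s = (\<Sum>i\<in>{1..n}. \<Sum>j\<in>{1..n}. c i * cnj (c j) * complex_of_real (f (g i - g j)))
        in Im s = 0 \<and> Re s \<ge> 0)"

definition P1 :: "('a::{ab_group_add, topological_space} \<Rightarrow> real) set" where
  "P1 = {f. continuous_on UNIV f \<and> positive_definite f \<and> f 0 = 1}"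

definition supp :: "('a::{zero,topological_space} \<Rightarrow> real) \<Rightarrow> 'a set" where
  "supp f = closure {x. f x \<noteq> 0}"

definition pos_part :: "('a \<Rightarrow> real) \<Rightarrow> 'a \<Rightarrow> real" where
  "pos_part f = (\<lambda>x. max (f x) 0)"

definition GG :: "'a::{ab_group_add, t2_space} measure \<Rightarrow> 'a set \<Rightarrow> ('a \<Rightarrow> real) set" where
  "GG M \<Omega> = {f. f \<in> P1 \<and> integrable M f \<and> supp (pos_part f) \<subseteq> \<Omega>}"

definition DD :: "'a::{ab_group_add, t2_space} measure \<Rightarrow> 'a set \<Rightarrow> ereal" where
  "DD M \<Omega> = (SUP f\<in>GG M \<Omega>. ereal (integral\<^sup>L M f))"

end

theory Submission
  imports Defs
begin

text \<open>Let \<open>K\<^sub>n\<close> be the convex set of admissible functions whose integral is at least \<open>D - 1/(n+1)\<close>.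
  Minimising the \<open>L\<^sup>2\<close> norm over the decreasing sequence \<open>K\<^sub>n\<close> gives, by the parallelogram law, a
  maximising sequence \<open>g\<^sub>n\<close> that is Cauchy in \<open>L\<^sup>2\<close>; no weak compactness is needed. Its limit has to be
  recognised as a continuous function. For a probability density \<open>\<phi>\<close> on a neighbourhood of \<open>0\<close>,
  the functions \<open>g\<^sub>n * \<phi>\<close> converge uniformly, and positive definiteness gives
  \<open>\<bar>(g\<^sub>n * \<phi>)(x)\<bar>\<^sup>2 \<le> Q\<^sub>n(\<phi>)\<close> for the quadratic form \<open>Q\<^sub>n\<close> with kernel \<open>g\<^sub>n\<close>. Minimising
  \<open>Q = lim Q\<^sub>n\<close> over densities on shrinking neighbourhoods, again by the parallelogram law, yields
  densities \<open>\<phi>\<^sub>k\<close> for which \<open>lim\<^sub>n (g\<^sub>n * \<phi>\<^sub>k)\<close> converges uniformly to some \<open>h\<close>, and \<open>g\<^sub>k \<longlonglongrightarrow> h\<close> in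
  \<open>L\<^sup>1\<close> on sets of finite measure. So \<open>h\<close> is continuous, positive definite, nonpositive off \<open>\<Omega>\<close>, with
  \<open>\<integral>h \<ge> D\<close> and \<open>h(0) \<le> 1\<close>. As \<open>h / h(0)\<close> is admissible and \<open>D > 0\<close>, it follows that \<open>h(0) = 1\<close>.\<close>

section \<open>Quadratic forms and minimising sequences\<close>

text \<open>Two obstacles shape the argument. The group need not be first countable, so there may be
  no sequence of neighbourhoods that shrinks to 0. The neighbourhoods carrying
  \<open>\<phi>\<^sub>n\<close> are therefore cut out by the moduli of continuity of
  \<open>g\<^sub>0, ..., g\<^sub>n\<close>, and closeness to \<open>g\<^sub>k\<close> is known only
  for the diagonal terms \<open>g\<^sub>k * \<phi>\<^sub>k\<close>. Moreover, integral norms are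
  blind to single points, so the normalisation at 0 might be lost in the limit; but if h(0) < 1,
  rescaling would push the integral above D.

  The L^2 norm is under control because an admissible function is at most 1 in modulus on \<Omega>
  and nonpositive elsewhere: a lower bound on its integral limits its negative mass, hence its L^1
  norm, hence its L^2 norm. Negative mass may still escape to infinity along the sequence. This can
  only raise the integral of the limit, which is why an inequality
  \<open>\<integral>h \<ge> D\<close> comes out and suffices. Once an extremal function exists, a
  constant sequence meets the last assertion.\<close>

lemma nonneg_quadratic:
  fixes a b c :: real
  assumes "0 \<le> a" and nn: "\<And>t. 0 \<le> a * t\<^sup>2 + 2 * b * t + c"
  shows "b\<^sup>2 \<le> a * c"
proof (cases "a = 0")
  case True
  have "b = 0"
  proof (rule ccontr)
    assume b: "b \<noteq> 0"
    \<comment> \<open>With \<open>a = 0\<close> the expression is affine in t; this t gives it the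
      value \<open>c - \<bar>c\<bar> - 1 < 0\<close>.\<close>
    have "0 \<le> a * (-(\<bar>c\<bar>+1)/(2*b))\<^sup>2 + 2 * b * (-(\<bar>c\<bar>+1)/(2*b)) + c" by (rule nn)
    moreover have "2 * b * (-(\<bar>c\<bar>+1)/(2*b)) = -(\<bar>c\<bar>+1)" using b by simp
    ultimately show False using True by simp
  qed
  with True show ?thesis by simp
next
  case False
  with assms(1) have "0 < a" by simp
  moreover have "0 \<le> a * (-b/a)\<^sup>2 + 2 * b * (-b/a) + c" by (rule nn)
  ultimately show ?thesis by (simp add: field_simps power2_eq_square)
qed

lemma integral_Cauchy_Schwarz:
  fixes u v :: "'b \<Rightarrow> real"
  assumes [measurable]: "u \<in> borel_measurable M" "v \<in> borel_measurable M"
    and u: "integrable M (\<lambda>x. (u x)\<^sup>2)" and v: "integrable M (\<lambda>x. (v x)\<^sup>2)"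
  shows "integrable M (\<lambda>x. u x * v x)"
    and "\<bar>\<integral>x. u x * v x \<partial>M\<bar> \<le> sqrt ((\<integral>x. (u x)\<^sup>2 \<partial>M) * (\<integral>x. (v x)\<^sup>2 \<partial>M))"
proof -
  show I: "integrable M (\<lambda>x. u x * v x)"
  proof (rule Bochner_Integration.integrable_bound[OF Bochner_Integration.integrable_add[OF u v]])
    show "AE x in M. norm (u x * v x) \<le> norm ((u x)\<^sup>2 + (v x)\<^sup>2)"
    proof (rule AE_I2)
      fix x
      have "2 * (u x * v x) \<le> (u x)\<^sup>2 + (v x)\<^sup>2" "- (2 * (u x * v x)) \<le> (u x)\<^sup>2 + (v x)\<^sup>2"
        using sum_squares_bound[of "u x" "v x"] sum_squares_bound[of "- u x" "v x"] by simp_all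
      then have "\<bar>u x * v x\<bar> \<le> (u x)\<^sup>2 + (v x)\<^sup>2"
        using zero_le_power2[of "u x"] zero_le_power2[of "v x"] by linarith
      then show "norm (u x * v x) \<le> norm ((u x)\<^sup>2 + (v x)\<^sup>2)" by simp
    qed
  qed measurable
  have "(\<integral>x. u x * v x \<partial>M)\<^sup>2 \<le> (\<integral>x. (u x)\<^sup>2 \<partial>M) * (\<integral>x. (v x)\<^sup>2 \<partial>M)"
  proof (rule nonneg_quadratic)
    show "0 \<le> (\<integral>x. (u x)\<^sup>2 \<partial>M)" by (rule integral_nonneg_AE) simp
  next
    fix t :: real
    have "0 \<le> (\<integral>x. (t * u x + v x)\<^sup>2 \<partial>M)" by (rule integral_nonneg_AE) simp
    also have "\<dots> = (\<integral>x. t\<^sup>2 * (u x)\<^sup>2 + 2 * t * (u x * v x) + (v x)\<^sup>2 \<partial>M)"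
      by (rule Bochner_Integration.integral_cong) (auto simp: power2_eq_square algebra_simps)
    also have "\<dots> = (\<integral>x. (u x)\<^sup>2 \<partial>M) * t\<^sup>2 + 2 * (\<integral>x. u x * v x \<partial>M) * t + (\<integral>x. (v x)\<^sup>2 \<partial>M)"
      using u v I by simp
    finally show "0 \<le> \<dots>" .
  qed
  then show "\<bar>\<integral>x. u x * v x \<partial>M\<bar> \<le> sqrt ((\<integral>x. (u x)\<^sup>2 \<partial>M) * (\<integral>x. (v x)\<^sup>2 \<partial>M))"
    by (simp add: real_le_rsqrt)
qed

text \<open>The Hilbert space projection argument with the space abstracted away: \<open>q\<close>
  plays the squared norm, \<open>d\<close> the squared distance and \<open>c\<close> the midpoint.
  The infima of \<open>q\<close> over the decreasing sets increase to a finite limit, so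
  near-minimisers have almost minimal midpoints and hence small distances. It serves twice: for
  admissible functions with the L^2 norm, and for densities with the limiting quadratic
  form.\<close>

lemma minimizing_sequence_Cauchy:
  fixes q :: "'b \<Rightarrow> real" and d :: "'b \<Rightarrow> 'b \<Rightarrow> real" and K :: "nat \<Rightarrow> 'b set"
  assumes nonneg: "\<And>n a. a \<in> K n \<Longrightarrow> 0 \<le> q a"
    and bound: "\<And>n. \<exists>a\<in>K n. q a \<le> B"
    and dec: "\<And>m n. m \<le> n \<Longrightarrow> K n \<subseteq> K m"
    and par: "\<And>n a b. a \<in> K n \<Longrightarrow> b \<in> K n \<Longrightarrow> \<exists>c\<in>K n. d a b \<le> 2 * q a + 2 * q b - 4 * q c"
  shows "\<exists>s. (\<forall>n. s n \<in> K n) \<and> (\<forall>e>0. \<exists>N. \<forall>m\<ge>N. \<forall>n\<ge>N. d (s m) (s n) < e)"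
proof -
  define r where "r n = Inf (q ` K n)" for n
  have bdd: "bdd_below (q ` K n)" for n using nonneg by (auto intro!: bdd_belowI[of _ 0])
  have ne: "K n \<noteq> {}" for n using bound by blast
  have rle: "r n \<le> q a" if "a \<in> K n" for n a
    unfolding r_def using that bdd by (intro cInf_lower) auto
  have inc: "incseq r"
  proof (rule incseq_SucI)
    fix n show "r n \<le> r (Suc n)" unfolding r_def
      using ne bdd dec[of n "Suc n"] by (intro cInf_superset_mono) auto
  qed
  have "r n \<le> B" for n using rle bound by (meson order_trans)
  then obtain L where L: "r \<longlonglongrightarrow> L" "\<And>n. r n \<le> L"
    using inc incseq_convergent[of r B] by auto
  have "\<exists>a\<in>K n. q a < r n + 1 / real (Suc n)" for n
  proof -
    have "\<exists>y\<in>q ` K n. y < r n + 1 / real (Suc n)" unfolding r_def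
      using ne bdd by (intro cInf_lessD) auto
    then show ?thesis by auto
  qed
  then obtain s where s: "\<And>n. s n \<in> K n" "\<And>n. q (s n) < r n + 1 / real (Suc n)" by metis
  show ?thesis
  proof (intro exI[of _ s] conjI allI impI s(1))
    fix e :: real assume e: "0 < e"
    \<comment> \<open>This is the bound that \<open>par\<close> yields beyond index N: each
      \<open>q\<close> is at most \<open>L + 1 / real (Suc N)\<close>, and the midpoint, lying in
      \<open>K N\<close>, has \<open>q\<close> at least \<open>r N\<close>.\<close>
    have "(\<lambda>N. 4 * (L + 1 / real (Suc N)) - 4 * r N) \<longlonglongrightarrow> 4 * (L + 0) - 4 * L"
      by (intro tendsto_intros L LIMSEQ_Suc lim_1_over_n)
    then have "eventually (\<lambda>N. 4 * (L + 1 / real (Suc N)) - 4 * r N < e) sequentially"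
      using e by (intro order_tendstoD) auto
    then obtain N where N: "4 * (L + 1 / real (Suc N)) - 4 * r N < e"
      by (auto simp: eventually_sequentially)
    show "\<exists>N. \<forall>m\<ge>N. \<forall>n\<ge>N. d (s m) (s n) < e"
    proof (intro exI[of _ N] allI impI)
      fix m n assume mn: "N \<le> m" "N \<le> n"
      have "s m \<in> K N" "s n \<in> K N" using s dec mn by blast+
      then obtain c where c: "c \<in> K N" "d (s m) (s n) \<le> 2 * q (s m) + 2 * q (s n) - 4 * q c"
        using par by blast
      define \<delta> where "\<delta> = L + 1 / real (Suc N)"
      have "q (s k) \<le> \<delta>" if "N \<le> k" for k
      proof -
        have "1 / real (Suc k) \<le> 1 / real (Suc N)" using that by (simp add: frac_le)
        with s(2)[of k] L(2)[of k] show ?thesis unfolding \<delta>_def by linarith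
      qed
      with mn have "q (s m) \<le> \<delta>" "q (s n) \<le> \<delta>" by auto
      with c(2) rle[OF c(1)] N[folded \<delta>_def] show "d (s m) (s n) < e" by linarith
    qed
  qed
qed

text \<open>Uniform continuity for the translation structure of the group, with neighbourhoods of 0
  in the role of entourages. \<open>V\<close> need not be symmetric: exchanging x and y gives the
  same bound for \<open>y - x \<in> V\<close>.\<close>

definition ucont :: "('a::{ab_group_add,topological_space} \<Rightarrow> real) \<Rightarrow> bool" where
  "ucont g \<longleftrightarrow> (\<forall>e>0. \<exists>V. open V \<and> 0 \<in> V \<and> (\<forall>x y. x - y \<in> V \<longrightarrow> \<bar>g x - g y\<bar> \<le> e))"

lemma translate_image: "(\<lambda>x. a + x) ` A = {x::'a::ab_group_add. x - a \<in> A}"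
proof (intro equalityI subsetI)
  fix x assume "x \<in> {x. x - a \<in> A}"
  then have "a + (x - a) \<in> (\<lambda>x. a + x) ` A" by blast
  then show "x \<in> (\<lambda>x. a + x) ` A" by simp
qed auto

section \<open>Positive definite functions\<close>

lemma positive_definiteD:
  assumes "positive_definite f"
  shows "Im (\<Sum>i\<in>{1..n}. \<Sum>j\<in>{1..n}. c i * cnj (c j) * complex_of_real (f (g i - g j))) = 0"
    and "Re (\<Sum>i\<in>{1..n::nat}. \<Sum>j\<in>{1..n}. c i * cnj (c j) * complex_of_real (f (g i - g j))) \<ge> 0"
  using assms unfolding positive_definite_def Let_def by blast+

text \<open>The coefficients 1 and i at the points x and 0 make the imaginary part of the form equal
  to \<open>f (- x) - f x\<close>. Complex coefficients are essential here, since a real form sees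
  only the even part of f.\<close>

lemma positive_definite_even:
  assumes "positive_definite f"
  shows "f (- x) = f x"
proof -
  define c :: "nat \<Rightarrow> complex" where "c = (\<lambda>i. if i = 1 then 1 else \<i>)"
  define g where "g = (\<lambda>i::nat. if i = 1 then x else 0)"
  have "Im (\<Sum>i\<in>{1..2}. \<Sum>j\<in>{1..2}. c i * cnj (c j) * complex_of_real (f (g i - g j))) = 0"
    by (rule positive_definiteD(1)[OF assms])
  then show ?thesis by (simp add: c_def g_def numeral_2_eq_2)
qed

lemma positive_definite_sum:
  assumes "positive_definite f" "finite I"
  shows "0 \<le> (\<Sum>i\<in>I. \<Sum>j\<in>I. w i * w j * f (p i - p j))"
proof -
  obtain h where h: "bij_betw h {1..card I} I" using ex_bij_betw_nat_finite_1[OF assms(2)] by blast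
  define c :: "nat \<Rightarrow> complex" where "c = (\<lambda>i. of_real (w (h i)))"
  have "Re (\<Sum>i\<in>{1..card I}. \<Sum>j\<in>{1..card I}. c i * cnj (c j) * complex_of_real (f (p (h i) - p (h j)))) \<ge> 0"
    by (rule positive_definiteD(2)[OF assms(1)])
  then have "0 \<le> (\<Sum>i\<in>{1..card I}. \<Sum>j\<in>{1..card I}. w (h i) * w (h j) * f (p (h i) - p (h j)))"
    by (simp add: c_def)
  also have "\<dots> = (\<Sum>i\<in>{1..card I}. \<Sum>j\<in>I. w (h i) * w j * f (p (h i) - p j))"
    by (intro sum.cong refl sum.reindex_bij_betw[OF h])
  also have "\<dots> = (\<Sum>i\<in>I. \<Sum>j\<in>I. w i * w j * f (p i - p j))"
    by (rule sum.reindex_bij_betw[OF h])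
  finally show ?thesis .
qed

text \<open>Evenness makes the matrix \<open>F\<close> symmetric, so the imaginary part cancels and
  the real part splits into the real forms of \<open>Re c\<close> and \<open>Im c\<close>.\<close>

lemma positive_definiteI:
  fixes f :: "'a::ab_group_add \<Rightarrow> real"
  assumes even: "\<And>x. f (- x) = f x"
    and form: "\<And>(n::nat) w (p :: nat \<Rightarrow> 'a). 0 \<le> (\<Sum>i\<in>{1..n}. \<Sum>j\<in>{1..n}. w i * w j * f (p i - p j))"
  shows "positive_definite f"
  unfolding positive_definite_def Let_def
proof (intro allI conjI)
  fix n :: nat and c :: "nat \<Rightarrow> complex" and g
  define F where "F (i::nat) (j::nat) = f (g i - g j)" for i j
  have sym: "F i j = F j i" for i j using even[of "g i - g j"] by (simp add: F_def)
  have "Im (\<Sum>i\<in>{1..n}. \<Sum>j\<in>{1..n}. c i * cnj (c j) * complex_of_real (F i j)) =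
      (\<Sum>i\<in>{1..n}. \<Sum>j\<in>{1..n}. Im (c i) * Re (c j) * F i j) -
      (\<Sum>i\<in>{1..n}. \<Sum>j\<in>{1..n}. Re (c i) * Im (c j) * F i j)"
    by (simp add: sum_subtractf [symmetric] algebra_simps)
  also have "(\<Sum>i\<in>{1..n}. \<Sum>j\<in>{1..n}. Re (c i) * Im (c j) * F i j) =
      (\<Sum>j\<in>{1..n}. \<Sum>i\<in>{1..n}. Im (c j) * Re (c i) * F j i)"
    by (subst sum.swap) (simp add: sym mult.commute)
  finally show "Im (\<Sum>i\<in>{1..n}. \<Sum>j\<in>{1..n}. c i * cnj (c j) * complex_of_real (f (g i - g j))) = 0"
    by (simp add: F_def)
  have "Re (\<Sum>i\<in>{1..n}. \<Sum>j\<in>{1..n}. c i * cnj (c j) * complex_of_real (f (g i - g j))) =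
      (\<Sum>i\<in>{1..n}. \<Sum>j\<in>{1..n}. Re (c i) * Re (c j) * f (g i - g j)) +
      (\<Sum>i\<in>{1..n}. \<Sum>j\<in>{1..n}. Im (c i) * Im (c j) * f (g i - g j))"
    by (simp add: sum.distrib [symmetric] algebra_simps)
  also have "\<dots> \<ge> 0" by (intro add_nonneg_nonneg form)
  finally show "Re (\<Sum>i\<in>{1..n}. \<Sum>j\<in>{1..n}. c i * cnj (c j) * complex_of_real (f (g i - g j))) \<ge> 0" .
qed

text \<open>Cauchy-Schwarz for the semi-inner product with kernel f, between a point mass at x and
  the measure with weights \<open>w\<close>. It is the discriminant of the form in which x carries a
  variable weight t; the leading coefficient is \<open>f 0 = 1\<close>.\<close>

lemma positive_definite_sum_square_le:
  assumes pd: "positive_definite f" and f0: "f 0 = 1" and Z: "finite Z"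
  shows "(\<Sum>b\<in>Z. w b * f (b - x))\<^sup>2 \<le> (\<Sum>a\<in>Z. \<Sum>b\<in>Z. w a * w b * f (a - b))"
proof -
  define S where "S = (\<Sum>b\<in>Z. w b * f (b - x))"
  define R where "R = (\<Sum>a\<in>Z. \<Sum>b\<in>Z. w a * w b * f (a - b))"
  have ev: "f (x - b) = f (b - x)" for b using positive_definite_even[OF pd, of "b - x"] by simp
  have "S\<^sup>2 \<le> 1 * R"
  proof (rule nonneg_quadratic)
    fix t :: real
    \<comment> \<open>\<open>None\<close> labels the extra point x, which keeps it separate from the
      points of \<open>Z\<close> even when x lies in \<open>Z\<close>.\<close>
    define I where "I = insert None (Some ` Z)"
    define W where "W i = (case i of None \<Rightarrow> t | Some b \<Rightarrow> w b)" for i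
    define p where "p i = (case i of None \<Rightarrow> x | Some b \<Rightarrow> b)" for i
    have "0 \<le> (\<Sum>i\<in>I. \<Sum>j\<in>I. W i * W j * f (p i - p j))"
      using Z by (intro positive_definite_sum pd) (simp add: I_def)
    also have "\<dots> = t\<^sup>2 + (\<Sum>b\<in>Z. t * w b * f (b - x)) + ((\<Sum>b\<in>Z. w b * t * f (b - x)) + R)"
      using Z f0 by (simp add: I_def W_def p_def sum.reindex sum.distrib ev R_def power2_eq_square)
    also have "\<dots> = 1 * t\<^sup>2 + 2 * S * t + R"
      by (simp add: S_def sum_distrib_left sum_distrib_right mult_ac flip: sum.distrib)
    finally show "0 \<le> 1 * t\<^sup>2 + 2 * S * t + R" .
  qed simp
  then show ?thesis by (simp add: S_def R_def)
qed

lemma positive_definite_abs_le: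
  assumes "positive_definite f"
  shows "\<bar>f x\<bar> \<le> f 0"
proof -
  have "0 \<le> 2 * f 0 + 2 * s * f x" if "s\<^sup>2 = 1" for s
    using positive_definite_sum[OF assms, of "{True, False}" "\<lambda>b. if b then 1 else s" "\<lambda>b. if b then x else 0"]
      positive_definite_even[OF assms, of x] that by (simp add: power2_eq_square)
  from this[of 1] this[of "- 1"] show ?thesis by (simp add: abs_le_iff)
qed

lemma positive_definite_abs_le_1:
  assumes "positive_definite f" "f 0 = 1"
  shows "\<bar>f x\<bar> \<le> 1"
  using positive_definite_abs_le[OF assms(1), of x] assms(2) by simp

text \<open>Krein's inequality: the preceding bound with weights 1 and -1 at x and y, tested at 0.
  It turns behaviour at 0 into uniform continuity.\<close>

lemma positive_definite_diff_square_le: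
  assumes "positive_definite f" "f 0 = 1"
  shows "(f x - f y)\<^sup>2 \<le> 2 * (1 - f (x - y))"
proof (cases "x = y")
  case False
  have ev: "f (y - x) = f (x - y)" using positive_definite_even[OF assms(1), of "x - y"] by simp
  show ?thesis
    using positive_definite_sum_square_le[OF assms, of "{x, y}" "\<lambda>z. if z = x then 1 else - 1" 0] False assms(2) ev
    by simp
qed (simp add: assms(2))

lemma integral_abs_le:
  fixes f g :: "'b \<Rightarrow> real"
  assumes "integrable M f" "integrable M g" "\<And>x. \<bar>f x\<bar> \<le> g x"
  shows "\<bar>\<integral>x. f x \<partial>M\<bar> \<le> (\<integral>x. g x \<partial>M)"
  by (rule order_trans[OF integral_abs_bound integral_mono]) (use assms in auto)

section \<open>Locally compact groups and Haar measure\<close>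

locale haar_group =
  fixes M :: "'a::{ab_group_add, t2_space} measure"
  assumes lca: "lca_group TYPE('a)" and haar: "haar_measure M"
begin

lemmas haarD = haar[unfolded haar_measure_def]

lemma sets_M [measurable_cong]: "sets M = sets borel"
  by (rule haarD[THEN conjunct1])

lemma space_M [simp]: "space M = UNIV"
  using sets_eq_imp_space_eq[OF sets_M] by simp

lemma continuous_add [continuous_intros]:
  fixes f g :: "'b::topological_space \<Rightarrow> 'a"
  assumes "continuous_on S f" "continuous_on S g"
  shows "continuous_on S (\<lambda>x. f x + g x)"
proof -
  have "continuous_on UNIV (\<lambda>p::'a \<times> 'a. fst p + snd p)" using lca by (simp add: lca_group_def)
  from continuous_on_compose2[OF this continuous_on_Pair[OF assms]] show ?thesis by simp
qed

lemma continuous_uminus [continuous_intros]: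
  fixes f :: "'b::topological_space \<Rightarrow> 'a"
  assumes "continuous_on S f"
  shows "continuous_on S (\<lambda>x. - f x)"
proof -
  have "continuous_on UNIV (uminus :: 'a \<Rightarrow> 'a)" using lca by (simp add: lca_group_def)
  from continuous_on_compose2[OF this assms] show ?thesis by simp
qed

lemma continuous_diff [continuous_intros]:
  fixes f g :: "'b::topological_space \<Rightarrow> 'a"
  assumes "continuous_on S f" "continuous_on S g"
  shows "continuous_on S (\<lambda>x. f x - g x)"
  using continuous_add[OF assms(1) continuous_uminus[OF assms(2)]] by simp

lemma measurable_continuous:
  "continuous_on UNIV f \<Longrightarrow> f \<in> borel_measurable M"
  using borel_measurable_continuous_onI measurable_cong_sets[OF sets_M refl] by blast

lemma continuous_diff_left: "continuous_on S (\<lambda>x::'a. x - a)"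
  by (rule continuous_diff[OF continuous_on_id continuous_on_const])

lemma continuous_diff_right: "continuous_on S (\<lambda>x::'a. a - x)"
  by (rule continuous_diff[OF continuous_on_const continuous_on_id])

lemma measurable_diff_left [measurable]: "(\<lambda>x. x - a) \<in> measurable M borel"
  using borel_measurable_continuous_onI[OF continuous_diff_left] measurable_cong_sets[OF sets_M refl] by blast

lemma open_vimage_diff_left: "open V \<Longrightarrow> open {x::'a. x - a \<in> V}"
  using open_vimage[OF _ continuous_diff_left[of UNIV a], of V] by (simp add: vimage_def)

lemma open_vimage_diff_right: "open V \<Longrightarrow> open {x::'a. a - x \<in> V}"
  using open_vimage[OF _ continuous_diff_right[of UNIV a], of V] by (simp add: vimage_def)

lemma nbhd_add:
  assumes "open V" "(a::'a) + b \<in> V"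
  shows "\<exists>A B. open A \<and> open B \<and> a \<in> A \<and> b \<in> B \<and> (\<forall>x\<in>A. \<forall>y\<in>B. x + y \<in> V)"
proof -
  have "open ((\<lambda>p::'a\<times>'a. fst p + snd p) -` V)"
    using lca assms(1) by (intro open_vimage) (auto simp: lca_group_def)
  moreover have "(a, b) \<in> (\<lambda>p::'a\<times>'a. fst p + snd p) -` V" using assms by simp
  ultimately obtain A B where AB: "open A" "open B" "(a,b) \<in> A \<times> B"
      "A \<times> B \<subseteq> (\<lambda>p::'a\<times>'a. fst p + snd p) -` V" by (rule open_prod_elim)
  then show ?thesis by (intro exI[of _ A] exI[of _ B]) force
qed

lemma nbhd_diff:
  assumes "open V" "(0::'a) \<in> V"
  shows "\<exists>W. open W \<and> 0 \<in> W \<and> (\<forall>x\<in>W. \<forall>y\<in>W. x - y \<in> V)"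
proof -
  obtain A B where AB: "open A" "open B" "0 \<in> A" "0 \<in> B" "\<forall>x\<in>A. \<forall>y\<in>B. x + y \<in> V"
    using nbhd_add[of V 0 0] assms by auto
  show ?thesis
    by (intro exI[of _ "A \<inter> {y. 0 - y \<in> B}"]) (use AB open_vimage_diff_right[of B 0] in force)
qed

text \<open>A tube argument: finitely many of the sets \<open>A c\<close> cover \<open>C\<close>,
  and the intersection of the corresponding \<open>W c\<close> works for all of \<open>C\<close> at
  once.\<close>

lemma compact_subset_open_translate:
  fixes C V :: "'a set"
  assumes "compact C" "open V" "C \<subseteq> V"
  shows "\<exists>W. open W \<and> 0 \<in> W \<and> (\<forall>c\<in>C. \<forall>w\<in>W. w + c \<in> V)"
proof -
  have "\<forall>c\<in>C. \<exists>A W. open A \<and> open W \<and> c \<in> A \<and> 0 \<in> W \<and> (\<forall>x\<in>A. \<forall>w\<in>W. x + w \<in> V)"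
    using assms nbhd_add[of V _ 0] by auto
  then obtain A W where AW: "\<And>c. c \<in> C \<Longrightarrow> open (A c) \<and> open (W c) \<and> c \<in> A c \<and> 0 \<in> W c \<and>
      (\<forall>x\<in>A c. \<forall>w\<in>W c. x + w \<in> V)" by metis
  obtain D where D: "D \<subseteq> C" "finite D" "C \<subseteq> (\<Union>c\<in>D. A c)"
  proof (rule compactE_image[OF assms(1), of C A])
    show "open (A c)" if "c \<in> C" for c using AW[OF that] by blast
    show "C \<subseteq> (\<Union>c\<in>C. A c)" using AW by (intro subsetI UN_I) auto
  qed
  have "\<forall>c\<in>D. open (W c)" "\<forall>c\<in>D. 0 \<in> W c" using D(1) AW by blast+
  then have "open (\<Inter>c\<in>D. W c)" "0 \<in> (\<Inter>c\<in>D. W c)" using D(2) by auto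
  moreover have "w + c \<in> V" if c: "c \<in> C" and w: "w \<in> (\<Inter>c\<in>D. W c)" for c w
  proof -
    obtain d where "d \<in> D" "c \<in> A d" using c D by blast
    then have "c + w \<in> V" using AW D w by blast
    then show ?thesis by (simp add: add.commute)
  qed
  ultimately show ?thesis by blast
qed

section \<open>Translation invariance and positivity of Haar measure\<close>

lemma compact_translate: "compact C \<Longrightarrow> compact ((\<lambda>x::'a. a + x) ` C)"
  by (intro compact_continuous_image continuous_intros)

lemma emeasure_translate:
  "A \<in> sets borel \<Longrightarrow> emeasure M ((\<lambda>x. g + x) ` A) = emeasure M A"
  by (rule haarD[THEN conjunct2, THEN conjunct2, THEN conjunct1, THEN bspec, THEN spec])

lemma emeasure_compact: "compact K \<Longrightarrow> emeasure M K < \<infinity>"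
  by (rule haarD[THEN conjunct2, THEN conjunct2, THEN conjunct2, THEN conjunct1, THEN spec, THEN mp])

lemma emeasure_open_inner:
  "open U \<Longrightarrow> emeasure M U = (SUP K\<in>{K. compact K \<and> K \<subseteq> U}. emeasure M K)"
  by (rule haarD[THEN conjunct2, THEN conjunct2, THEN conjunct2, THEN conjunct2, THEN conjunct2, THEN spec, THEN mp])

lemma measurable_diff_left': "(\<lambda>x. x - a) \<in> measurable M M"
  using measurable_diff_left measurable_cong_sets[OF refl sets_M, of M] by simp

lemma distr_translate: "distr M M (\<lambda>x. x - a) = M"
proof (rule measure_eqI)
  show "sets (distr M M (\<lambda>x. x - a)) = sets M" by simp
  fix A assume "A \<in> sets (distr M M (\<lambda>x. x - a))"
  then have A: "A \<in> sets M" by simp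
  have "(\<lambda>x. x - a) -` A = (\<lambda>x. a + x) ` A"
    by (auto simp: translate_image)
  then show "emeasure (distr M M (\<lambda>x. x - a)) A = emeasure M A"
    using A emeasure_translate[of A a] by (simp add: emeasure_distr measurable_diff_left' sets_M)
qed

lemma integral_translate:
  fixes f :: "'a \<Rightarrow> real"
  assumes "f \<in> borel_measurable M"
  shows "(\<integral>x. f (x - a) \<partial>M) = (\<integral>x. f x \<partial>M)"
    and "integrable M (\<lambda>x. f (x - a)) \<longleftrightarrow> integrable M f"
proof -
  show "(\<integral>x. f (x - a) \<partial>M) = (\<integral>x. f x \<partial>M)"
    using integral_distr[OF measurable_diff_left' assms] by (simp add: distr_translate)
  show "integrable M (\<lambda>x. f (x - a)) \<longleftrightarrow> integrable M f"
    using integrable_distr_eq[OF measurable_diff_left' assms] by (simp add: distr_translate)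
qed

text \<open>If U were null, every compact set, being covered by finitely many translates of U, would
  be null too. Inner regularity of the whole space would then make the measure vanish.\<close>

lemma emeasure_open_pos:
  assumes "open U" "U \<noteq> {}"
  shows "emeasure M U > 0"
proof (rule ccontr)
  assume "\<not> ?thesis"
  then have U0: "emeasure M U = 0" by simp
  obtain u where u: "u \<in> U" using assms by blast
  have "emeasure M K = 0" if K: "compact K" for K
  proof -
    have op: "open ((\<lambda>x. (k - u) + x) ` U)" for k
      using open_vimage_diff_left[OF assms(1)] by (simp only: translate_image)
    obtain D where D: "D \<subseteq> K" "finite D" "K \<subseteq> (\<Union>k\<in>D. (\<lambda>x. (k - u) + x) ` U)"
    proof (rule compactE_image[OF K, of K "\<lambda>k. (\<lambda>x. (k - u) + x) ` U"])
      show "K \<subseteq> (\<Union>c\<in>K. (\<lambda>x. (c - u) + x) ` U)" unfolding translate_image using u by auto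
    qed (use op in auto)
    have "emeasure M K \<le> emeasure M (\<Union>k\<in>D. (\<lambda>x. (k - u) + x) ` U)"
      using D op by (intro emeasure_mono) (auto simp: sets_M)
    also have "\<dots> \<le> (\<Sum>k\<in>D. emeasure M ((\<lambda>x. (k - u) + x) ` U))"
      using D op by (intro emeasure_subadditive_finite) (auto simp: sets_M)
    also have "\<dots> = 0" using emeasure_translate U0 assms by simp
    finally show ?thesis by simp
  qed
  then have "(SUP K\<in>{K. compact K \<and> K \<subseteq> UNIV}. emeasure M K) \<le> 0"
    by (intro SUP_least) auto
  then have "emeasure M UNIV = 0" using emeasure_open_inner[of UNIV] by simp
  then show False using haarD[THEN conjunct2, THEN conjunct1] by simp
qed

lemma measure_open_pos:
  assumes "open U" "U \<noteq> {}" "emeasure M U < \<infinity>"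
  shows "0 < measure M U"
  using emeasure_open_pos[OF assms(1,2)] assms(3) by (simp add: measure_def enn2real_positive_iff)

lemma ucont_continuous:
  assumes "ucont (g :: 'a \<Rightarrow> real)"
  shows "continuous_on UNIV g"
  unfolding continuous_on_def
proof (intro ballI tendstoI)
  fix x :: 'a and e :: real assume e: "0 < e"
  obtain V where V: "open V" "0 \<in> V" "\<And>x y. x - y \<in> V \<Longrightarrow> \<bar>g x - g y\<bar> \<le> e / 2"
    using assms e by (metis ucont_def half_gt_zero)
  have "eventually (\<lambda>y. y \<in> {y. y - x \<in> V}) (at x)"
    using open_vimage_diff_left[OF V(1), of x] V(2) by (intro topological_tendstoD[OF tendsto_ident_at]) auto
  then show "eventually (\<lambda>y. dist (g y) (g x) < e) (at x)"
    by eventually_elim (use V(3) e in \<open>force simp: dist_real_def\<close>)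
qed

lemma ucont_diff:
  assumes "ucont (g :: 'a \<Rightarrow> real)" "ucont h"
  shows "ucont (\<lambda>x. g x - h x)"
  unfolding ucont_def
proof (intro allI impI)
  fix e :: real assume e: "0 < e"
  obtain V where V: "open V" "0 \<in> V" "\<And>x y. x - y \<in> V \<Longrightarrow> \<bar>g x - g y\<bar> \<le> e / 2"
    using assms e by (metis ucont_def half_gt_zero)
  obtain W where W: "open W" "0 \<in> W" "\<And>x y. x - y \<in> W \<Longrightarrow> \<bar>h x - h y\<bar> \<le> e / 2"
    using assms e by (metis ucont_def half_gt_zero)
  show "\<exists>V. open V \<and> 0 \<in> V \<and> (\<forall>x y. x - y \<in> V \<longrightarrow> \<bar>g x - h x - (g y - h y)\<bar> \<le> e)"
  proof (intro exI[of _ "V \<inter> W"] conjI allI impI)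
    fix x y assume "x - y \<in> V \<inter> W"
    then have "\<bar>g x - g y\<bar> \<le> e / 2" "\<bar>h x - h y\<bar> \<le> e / 2" using V(3)[of x y] W(3)[of x y] by auto
    then show "\<bar>g x - h x - (g y - h y)\<bar> \<le> e" by linarith
  qed (use V W in auto)
qed

text \<open>Only a lower bound near 0 has to be checked, by Krein's inequality with
  \<open>e\<^sup>2 / 2\<close>. For the autocorrelation used later this bound comes straight from
  inner regularity.\<close>

lemma positive_definite_ucont:
  assumes pd: "positive_definite f" and f0: "f 0 = 1"
    and at0: "\<And>e. 0 < e \<Longrightarrow> \<exists>V. open V \<and> (0::'a) \<in> V \<and> (\<forall>x\<in>V. 1 - e \<le> f x)"
  shows "ucont f"
  unfolding ucont_def
proof (intro allI impI)
  fix e :: real assume e: "0 < e"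
  then obtain V where V: "open V" "0 \<in> V" "\<forall>x\<in>V. 1 - e\<^sup>2 / 2 \<le> f x" using at0[of "e\<^sup>2 / 2"] by auto
  show "\<exists>V. open V \<and> 0 \<in> V \<and> (\<forall>x y. x - y \<in> V \<longrightarrow> \<bar>f x - f y\<bar> \<le> e)"
  proof (intro exI[of _ V] conjI V allI impI)
    fix x y assume "x - y \<in> V"
    with V have "1 - e\<^sup>2 / 2 \<le> f (x - y)" by blast
    then have "2 * (1 - f (x - y)) \<le> e\<^sup>2" by simp
    with positive_definite_diff_square_le[OF pd f0, of x y] have "(f x - f y)\<^sup>2 \<le> e\<^sup>2" by linarith
    then show "\<bar>f x - f y\<bar> \<le> e" using e by (simp add: abs_le_square_iff[symmetric])
  qed
qed

lemma P1_ucont: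
  assumes "f \<in> P1"
  shows "ucont (f :: 'a \<Rightarrow> real)"
proof (rule positive_definite_ucont)
  fix e :: real assume e: "0 < e"
  have cont: "continuous_on UNIV f" and f0: "f 0 = 1" using assms by (auto simp: P1_def)
  have "open (f -` {1 - e<..})" by (rule open_vimage[OF _ cont]) simp
  moreover have "0 \<in> f -` {1 - e<..}" using e f0 by simp
  ultimately show "\<exists>V. open V \<and> (0::'a) \<in> V \<and> (\<forall>x\<in>V. 1 - e \<le> f x)" by force
qed (use assms in \<open>auto simp: P1_def\<close>)

section \<open>Integrals against bounded functions and their discretisation\<close>

lemma integrable_mult_bounded:
  fixes H \<phi> :: "'a \<Rightarrow> real"
  assumes "H \<in> borel_measurable M" "\<And>x. \<bar>H x\<bar> \<le> B" "integrable M \<phi>"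
  shows "integrable M (\<lambda>x. H x * \<phi> x)"
proof (rule Bochner_Integration.integrable_bound[OF integrable_mult_right[OF integrable_abs[OF assms(3)], of B]])
  show "(\<lambda>x. H x * \<phi> x) \<in> borel_measurable M"
    using assms(1) borel_measurable_integrable[OF assms(3)] by measurable
  show "AE x in M. norm (H x * \<phi> x) \<le> norm (B * \<bar>\<phi> x\<bar>)"
  proof (rule AE_I2)
    fix x
    have "\<bar>H x\<bar> * \<bar>\<phi> x\<bar> \<le> \<bar>B\<bar> * \<bar>\<phi> x\<bar>" using assms(2)[of x] by (intro mult_right_mono) auto
    then show "norm (H x * \<phi> x) \<le> norm (B * \<bar>\<phi> x\<bar>)" by (simp add: abs_mult)
  qed
qed

lemma integral_mult_le:
  fixes H \<phi> :: "'a \<Rightarrow> real"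
  assumes "integrable M (\<lambda>x. H x * \<phi> x)" "integrable M \<phi>" "\<And>x. \<phi> x \<noteq> 0 \<Longrightarrow> \<bar>H x\<bar> \<le> B"
  shows "\<bar>\<integral>x. H x * \<phi> x \<partial>M\<bar> \<le> B * (\<integral>x. \<bar>\<phi> x\<bar> \<partial>M)"
proof -
  have "\<bar>\<integral>x. H x * \<phi> x \<partial>M\<bar> \<le> (\<integral>x. B * \<bar>\<phi> x\<bar> \<partial>M)"
  proof (rule integral_abs_le)
    show "\<bar>H x * \<phi> x\<bar> \<le> B * \<bar>\<phi> x\<bar>" for x
      using assms(3)[of x] by (cases "\<phi> x = 0") (auto simp: abs_mult intro!: mult_right_mono)
  qed (use assms in auto)
  then show ?thesis by simp
qed

text \<open>Replacing integration against \<open>\<phi>\<close> by a finite sum, uniformly over all integrands of the same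
  modulus of continuity, takes the place of Fubini's theorem, which is not available because \<open>M\<close> need
  not be \<open>\<sigma>\<close>-finite and continuous functions of two variables need not be product measurable.\<close>

lemma discretize_cover:
  fixes \<phi> :: "'a \<Rightarrow> real"
  assumes "finite Z" "open V" "(0::'a) \<in> V"
  shows "integrable M \<phi> \<Longrightarrow> (\<And>x. \<phi> x \<noteq> 0 \<Longrightarrow> \<exists>b\<in>Z. x - b \<in> V) \<Longrightarrow>
    \<exists>w. (\<Sum>b\<in>Z. \<bar>w b\<bar>) \<le> (\<integral>x. \<bar>\<phi> x\<bar> \<partial>M) \<and>
      (\<forall>H B e. continuous_on UNIV H \<longrightarrow> (\<forall>x. \<bar>H x\<bar> \<le> B) \<longrightarrow> (\<forall>z b. z - b \<in> V \<longrightarrow> \<bar>H z - H b\<bar> \<le> e) \<longrightarrow>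
        \<bar>(\<integral>x. H x * \<phi> x \<partial>M) - (\<Sum>b\<in>Z. w b * H b)\<bar> \<le> e * (\<integral>x. \<bar>\<phi> x\<bar> \<partial>M))"
  using assms(1)
proof (induction Z arbitrary: \<phi> rule: finite_induct)
  case empty
  then have "\<phi> = (\<lambda>_. 0)" by auto
  then show ?case by simp
next
  case (insert b Z)
  \<comment> \<open>The part of \<phi> on the translate \<open>b + V\<close> is split off; what
    remains lives on the translates belonging to \<open>Z\<close>.\<close>
  define A where "A = {x. x - b \<in> V}"
  have A: "A \<in> sets M" using open_vimage_diff_left[OF assms(2)] by (simp add: A_def sets_M)
  define \<phi>1 where "\<phi>1 x = \<phi> x * indicator A x" for x
  define \<phi>2 where "\<phi>2 x = \<phi> x * indicator (- A) x" for x
  have split: "\<phi> x = \<phi>1 x + \<phi>2 x" "\<bar>\<phi> x\<bar> = \<bar>\<phi>1 x\<bar> + \<bar>\<phi>2 x\<bar>" for x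
    by (auto simp: \<phi>1_def \<phi>2_def indicator_def)
  have i: "integrable M \<phi>1" "integrable M \<phi>2"
    unfolding \<phi>1_def[abs_def] \<phi>2_def[abs_def]
    using A sets.compl_sets[OF A] insert.prems(1) by (auto intro!: integrable_real_mult_indicator simp: Compl_eq_Diff_UNIV)
  have N: "(\<integral>x. \<bar>\<phi> x\<bar> \<partial>M) = (\<integral>x. \<bar>\<phi>1 x\<bar> \<partial>M) + (\<integral>x. \<bar>\<phi>2 x\<bar> \<partial>M)"
    using i by (simp add: split(2))
  have "\<exists>c\<in>Z. x - c \<in> V" if "\<phi>2 x \<noteq> 0" for x
    using insert.prems(2)[of x] that by (auto simp: \<phi>2_def A_def indicator_def split: if_splits)
  from insert.IH[OF i(2) this] obtain w where w: "(\<Sum>b\<in>Z. \<bar>w b\<bar>) \<le> (\<integral>x. \<bar>\<phi>2 x\<bar> \<partial>M)"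
    "\<And>H B e. continuous_on UNIV H \<Longrightarrow> (\<forall>x. \<bar>H x\<bar> \<le> B) \<Longrightarrow> (\<forall>z b. z - b \<in> V \<longrightarrow> \<bar>H z - H b\<bar> \<le> e) \<Longrightarrow>
        \<bar>(\<integral>x. H x * \<phi>2 x \<partial>M) - (\<Sum>b\<in>Z. w b * H b)\<bar> \<le> e * (\<integral>x. \<bar>\<phi>2 x\<bar> \<partial>M)" by blast
  \<comment> \<open>The split-off mass is concentrated at b. On \<open>A\<close> the integrand
    differs from \<open>H b\<close> by at most e, so the error is at most e times the L^1 norm of
    \<open>\<phi>1\<close>.\<close>
  define w' where "w' = w(b := \<integral>x. \<phi>1 x \<partial>M)"
  have sum: "(\<Sum>c\<in>insert b Z. F c (w' c)) = F b (\<integral>x. \<phi>1 x \<partial>M) + (\<Sum>c\<in>Z. F c (w c))" for F :: "'a \<Rightarrow> real \<Rightarrow> real"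
  proof -
    have "(\<Sum>c\<in>Z. F c (w' c)) = (\<Sum>c\<in>Z. F c (w c))"
      using insert.hyps by (intro sum.cong) (auto simp: w'_def)
    then show ?thesis using insert.hyps by (simp add: w'_def)
  qed
  show ?case
  proof (intro exI[of _ w'] conjI allI impI)
    have "\<bar>\<integral>x. \<phi>1 x \<partial>M\<bar> \<le> (\<integral>x. \<bar>\<phi>1 x\<bar> \<partial>M)" by (rule integral_abs_bound)
    then show "(\<Sum>b\<in>insert b Z. \<bar>w' b\<bar>) \<le> (\<integral>x. \<bar>\<phi> x\<bar> \<partial>M)"
      using w(1) sum[of "\<lambda>_. abs"] N by linarith
    fix H :: "'a \<Rightarrow> real" and B e assume H: "continuous_on UNIV H" "\<forall>x. \<bar>H x\<bar> \<le> B" "\<forall>z b. z - b \<in> V \<longrightarrow> \<bar>H z - H b\<bar> \<le> e"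
    have iH: "integrable M (\<lambda>x. H x * \<phi>1 x)" "integrable M (\<lambda>x. H x * \<phi>2 x)"
      using i H by (auto intro!: integrable_mult_bounded measurable_continuous)
    have "\<bar>\<integral>x. (H x - H b) * \<phi>1 x \<partial>M\<bar> \<le> e * (\<integral>x. \<bar>\<phi>1 x\<bar> \<partial>M)"
    proof (rule integral_mult_le[OF _ i(1)])
      show "integrable M (\<lambda>x. (H x - H b) * \<phi>1 x)" using iH i by (simp add: left_diff_distrib)
      show "\<bar>H x - H b\<bar> \<le> e" if "\<phi>1 x \<noteq> 0" for x
        using that H(3) by (auto simp: \<phi>1_def A_def indicator_def split: if_splits)
    qed
    moreover have "(\<integral>x. (H x - H b) * \<phi>1 x \<partial>M) = (\<integral>x. H x * \<phi>1 x \<partial>M) - H b * (\<integral>x. \<phi>1 x \<partial>M)"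
      using iH i by (simp add: left_diff_distrib)
    moreover have "(\<integral>x. H x * \<phi> x \<partial>M) = (\<integral>x. H x * \<phi>1 x \<partial>M) + (\<integral>x. H x * \<phi>2 x \<partial>M)"
      using iH by (simp add: split(1) distrib_left)
    moreover have "(\<Sum>c\<in>insert b Z. w' c * H c) = H b * (\<integral>x. \<phi>1 x \<partial>M) + (\<Sum>c\<in>Z. w c * H c)"
      using sum[of "\<lambda>c y. y * H c"] by (simp add: mult.commute)
    moreover have "e * (\<integral>x. \<bar>\<phi> x\<bar> \<partial>M) = e * (\<integral>x. \<bar>\<phi>1 x\<bar> \<partial>M) + e * (\<integral>x. \<bar>\<phi>2 x\<bar> \<partial>M)"
      by (simp add: N distrib_left)
    ultimately show "\<bar>(\<integral>x. H x * \<phi> x \<partial>M) - (\<Sum>b\<in>insert b Z. w' b * H b)\<bar> \<le> e * (\<integral>x. \<bar>\<phi> x\<bar> \<partial>M)"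
      using w(2)[OF H] by linarith
  qed
qed

text \<open>Square integrability serves the Cauchy-Schwarz bound \<open>conv_sup_bound\<close>,
  compact support the finite covers in \<open>discretize\<close>. Continuity is not demanded, so
  that indicators of relatively compact open sets qualify.\<close>

definition test_fun :: "('a \<Rightarrow> real) \<Rightarrow> bool" where
  "test_fun \<phi> \<longleftrightarrow> integrable M \<phi> \<and> integrable M (\<lambda>x. (\<phi> x)\<^sup>2) \<and> (\<exists>K. compact K \<and> (\<forall>x. x \<notin> K \<longrightarrow> \<phi> x = 0))"

lemma test_fun_integrable: "test_fun \<phi> \<Longrightarrow> integrable M \<phi>"
  by (simp add: test_fun_def)

lemma discretize:
  assumes "test_fun \<phi>" "open V" "(0::'a) \<in> V"
  obtains Z w where "finite Z" "(\<Sum>b\<in>Z. \<bar>w b\<bar>) \<le> (\<integral>x. \<bar>\<phi> x\<bar> \<partial>M)"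
    "\<And>H B e. continuous_on UNIV H \<Longrightarrow> (\<And>x. \<bar>H x\<bar> \<le> B) \<Longrightarrow> (\<And>z b. z - b \<in> V \<Longrightarrow> \<bar>H z - H b\<bar> \<le> e) \<Longrightarrow>
        \<bar>(\<integral>x. H x * \<phi> x \<partial>M) - (\<Sum>b\<in>Z. w b * H b)\<bar> \<le> e * (\<integral>x. \<bar>\<phi> x\<bar> \<partial>M)"
proof -
  obtain K where K: "compact K" "\<And>x. \<phi> x \<noteq> 0 \<Longrightarrow> x \<in> K" using assms(1) by (auto simp: test_fun_def)
  obtain Z where Z: "Z \<subseteq> K" "finite Z" "K \<subseteq> (\<Union>b\<in>Z. {x. x - b \<in> V})"
  proof (rule compactE_image[OF K(1), of K "\<lambda>b. {x. x - b \<in> V}"])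
    show "K \<subseteq> (\<Union>c\<in>K. {x. x - c \<in> V})" using assms(3) by auto
  qed (use assms(2) in \<open>auto intro: open_vimage_diff_left\<close>)
  have "\<exists>b\<in>Z. x - b \<in> V" if "\<phi> x \<noteq> 0" for x using K(2)[OF that] Z(3) by blast
  from discretize_cover[OF Z(2) assms(2,3) test_fun_integrable[OF assms(1)] this]
  obtain w where "(\<Sum>b\<in>Z. \<bar>w b\<bar>) \<le> (\<integral>x. \<bar>\<phi> x\<bar> \<partial>M)"
    "\<And>H B e. continuous_on UNIV H \<longrightarrow> (\<forall>x. \<bar>H x\<bar> \<le> B) \<longrightarrow> (\<forall>z b. z - b \<in> V \<longrightarrow> \<bar>H z - H b\<bar> \<le> e) \<longrightarrow>
        \<bar>(\<integral>x. H x * \<phi> x \<partial>M) - (\<Sum>b\<in>Z. w b * H b)\<bar> \<le> e * (\<integral>x. \<bar>\<phi> x\<bar> \<partial>M)" by blast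
  then show ?thesis using that[of Z w] Z(2) by blast
qed

lemma indicator_mult_integrable:
  assumes "continuous_on UNIV u" "\<And>x. \<bar>u x\<bar> \<le> B" "A \<in> sets M" "emeasure M A < \<infinity>"
  shows "integrable M (\<lambda>x. indicator A x * (u x :: real))"
proof -
  have "integrable M (indicator A :: 'a \<Rightarrow> real)" using assms by (simp add: integrable_indicator_iff)
  from integrable_mult_bounded[OF measurable_continuous[OF assms(1)] assms(2) this] show ?thesis
    by (simp add: mult.commute)
qed

section \<open>Convolution with test functions\<close>

text \<open>The kernel is \<open>g (z - x)\<close>, not \<open>g (x - z)\<close>: then only translation invariance of \<open>M\<close> is needed,
  as its invariance under \<open>x \<mapsto> - x\<close> is not part of the hypotheses.\<close>

definition conv :: "('a \<Rightarrow> real) \<Rightarrow> ('a \<Rightarrow> real) \<Rightarrow> 'a \<Rightarrow> real" where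
  "conv g \<phi> x = (\<integral>z. g (z - x) * \<phi> z \<partial>M)"

text \<open>The iterated integral of \<open>g (z - y) * \<phi> z * \<psi> y\<close> with z
  integrated first. Exchanging the order is a separate matter, settled by
  \<open>conv_form_sym\<close> for even kernels.\<close>

definition conv_form :: "('a \<Rightarrow> real) \<Rightarrow> ('a \<Rightarrow> real) \<Rightarrow> ('a \<Rightarrow> real) \<Rightarrow> real" where
  "conv_form g \<phi> \<psi> = (\<integral>y. conv g \<phi> y * \<psi> y \<partial>M)"

lemma continuous_translate:
  fixes g :: "'a \<Rightarrow> real"
  assumes "continuous_on UNIV g"
  shows "continuous_on UNIV (\<lambda>z. g (z - x))"
  using continuous_on_compose2[OF assms continuous_diff_left] by auto

lemma conv_integrable:
  fixes B :: real
  assumes "continuous_on UNIV g" "\<And>x. \<bar>g x\<bar> \<le> B" "integrable M \<phi>"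
  shows "integrable M (\<lambda>z. g (z - x) * \<phi> z)"
  using assms by (intro integrable_mult_bounded[where B = B] measurable_continuous continuous_translate)

lemma conv_bound:
  fixes B :: real
  assumes "continuous_on UNIV g" "\<And>x. \<bar>g x\<bar> \<le> B" "integrable M \<phi>"
  shows "\<bar>conv g \<phi> x\<bar> \<le> B * (\<integral>x. \<bar>\<phi> x\<bar> \<partial>M)"
  unfolding conv_def using assms by (intro integral_mult_le conv_integrable[where B = B])

text \<open>Since \<open>(z - x) - (z - y) = y - x\<close>, the modulus of g passes to the
  convolution with the order of the points reversed, scaled by the L^1 norm of \<phi>.\<close>

lemma conv_modulus:
  assumes g: "continuous_on UNIV g" "\<And>x. \<bar>g x\<bar> \<le> B" and \<phi>: "integrable M \<phi>"
    and e: "\<And>x y. x - y \<in> V \<Longrightarrow> \<bar>g x - g y\<bar> \<le> e" and xy: "y - x \<in> V"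
  shows "\<bar>conv g \<phi> x - conv g \<phi> y\<bar> \<le> e * (\<integral>x. \<bar>\<phi> x\<bar> \<partial>M)"
proof -
  note i = conv_integrable[OF g \<phi>]
  have "conv g \<phi> x - conv g \<phi> y = (\<integral>z. (g (z - x) - g (z - y)) * \<phi> z \<partial>M)"
    using i[of x] i[of y] by (simp add: conv_def left_diff_distrib)
  also have "\<bar>\<dots>\<bar> \<le> e * (\<integral>x. \<bar>\<phi> x\<bar> \<partial>M)"
  proof (rule integral_mult_le[OF _ \<phi>])
    show "integrable M (\<lambda>z. (g (z - x) - g (z - y)) * \<phi> z)" using i[of x] i[of y] by (simp add: left_diff_distrib)
    show "\<bar>g (z - x) - g (z - y)\<bar> \<le> e" for z using e[of "z - x" "z - y"] xy by simp
  qed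
  finally show ?thesis .
qed

lemma integral_abs_nonneg: "0 \<le> (\<integral>x. \<bar>\<phi> x :: real\<bar> \<partial>M)"
  by (rule Bochner_Integration.integral_nonneg) simp

lemma conv_ucont:
  assumes g: "ucont g" "\<And>x. \<bar>g x\<bar> \<le> B" and \<phi>: "integrable M \<phi>"
  shows "ucont (conv g \<phi>)"
  unfolding ucont_def
proof (intro allI impI)
  fix e :: real assume e: "0 < e"
  define N where "N = (\<integral>x. \<bar>\<phi> x\<bar> \<partial>M)"
  have N: "0 \<le> N" unfolding N_def by (rule integral_abs_nonneg)
  obtain V where V: "open V" "0 \<in> V" "\<And>x y. x - y \<in> V \<Longrightarrow> \<bar>g x - g y\<bar> \<le> e / (N + 1)"
    using g(1)[unfolded ucont_def, rule_format, of "e / (N + 1)"] e N by auto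
  show "\<exists>V. open V \<and> 0 \<in> V \<and> (\<forall>x y. x - y \<in> V \<longrightarrow> \<bar>conv g \<phi> x - conv g \<phi> y\<bar> \<le> e)"
  proof (intro exI[of _ V] conjI V allI impI)
    fix x y assume "x - y \<in> V"
    then have "\<bar>conv g \<phi> y - conv g \<phi> x\<bar> \<le> e / (N + 1) * N"
      unfolding N_def by (intro conv_modulus[OF ucont_continuous[OF g(1)] g(2) \<phi>, of V]) (use V N_def in auto)
    also have "\<dots> \<le> e" using N e by (simp add: field_simps)
    finally show "\<bar>conv g \<phi> x - conv g \<phi> y\<bar> \<le> e" by (simp add: abs_minus_commute)
  qed
qed

lemma conv_add:
  assumes "continuous_on UNIV g" "\<And>x. \<bar>g x\<bar> \<le> B" "integrable M \<phi>" "integrable M \<psi>"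
  shows "conv g (\<lambda>z. a * \<phi> z + b * \<psi> z) x = a * conv g \<phi> x + b * conv g \<psi> x"
proof -
  note i = conv_integrable[OF assms(1,2)]
  have "conv g (\<lambda>z. a * \<phi> z + b * \<psi> z) x = (\<integral>z. a * (g (z - x) * \<phi> z) + b * (g (z - x) * \<psi> z) \<partial>M)"
    unfolding conv_def by (rule Bochner_Integration.integral_cong) (auto simp: algebra_simps)
  then show ?thesis using i[OF assms(3), of x] i[OF assms(4), of x] by (simp add: conv_def)
qed

lemma conv_form_integrable:
  fixes B :: real
  assumes "ucont g" "\<And>x. \<bar>g x\<bar> \<le> B" "integrable M \<phi>" "integrable M \<psi>"
  shows "integrable M (\<lambda>y. conv g \<phi> y * \<psi> y)"
  using assms
  by (intro integrable_mult_bounded[OF measurable_continuous conv_bound[where B = B]] ucont_continuous conv_ucont)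

lemma conv_form_bound:
  assumes "ucont g" "\<And>x. \<bar>g x\<bar> \<le> B" "integrable M \<phi>" "integrable M \<psi>" "\<And>x. \<bar>conv g \<phi> x\<bar> \<le> C"
  shows "\<bar>conv_form g \<phi> \<psi>\<bar> \<le> C * (\<integral>x. \<bar>\<psi> x\<bar> \<partial>M)"
  unfolding conv_form_def by (rule integral_mult_le[OF conv_form_integrable]) (use assms in auto)

lemma conv_form_bilinear:
  assumes g: "ucont g" "\<And>x. \<bar>g x\<bar> \<le> B" and i: "integrable M \<phi>" "integrable M \<psi>"
  shows "conv_form g (\<lambda>z. a * \<phi> z + b * \<psi> z) (\<lambda>z. a * \<phi> z + b * \<psi> z) =
    a\<^sup>2 * conv_form g \<phi> \<phi> + a * b * conv_form g \<phi> \<psi> + a * b * conv_form g \<psi> \<phi> + b\<^sup>2 * conv_form g \<psi> \<psi>"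
proof -
  note ii = conv_form_integrable[OF g]
  have "conv_form g (\<lambda>z. a * \<phi> z + b * \<psi> z) (\<lambda>z. a * \<phi> z + b * \<psi> z) =
    (\<integral>y. a\<^sup>2 * (conv g \<phi> y * \<phi> y) + a * b * (conv g \<phi> y * \<psi> y) + a * b * (conv g \<psi> y * \<phi> y) + b\<^sup>2 * (conv g \<psi> y * \<psi> y) \<partial>M)"
    unfolding conv_form_def
    by (rule Bochner_Integration.integral_cong[OF refl], subst conv_add[OF ucont_continuous[OF g(1)] g(2) i])
       (simp add: power2_eq_square algebra_simps)
  then show ?thesis
    using ii[OF i(1) i(1)] ii[OF i(1) i(2)] ii[OF i(2) i(1)] ii[OF i(2) i(2)] by (simp add: conv_form_def)
qed

lemma ucont_nbhd_symmetric:
  assumes "ucont (g :: 'a \<Rightarrow> real)" "0 < e"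
  obtains V where "open V" "0 \<in> V" "\<And>x y. x - y \<in> V \<Longrightarrow> \<bar>g x - g y\<bar> \<le> e" "\<And>x y. y - x \<in> V \<Longrightarrow> \<bar>g x - g y\<bar> \<le> e"
proof -
  obtain V where V: "open V" "0 \<in> V" "\<And>x y. x - y \<in> V \<Longrightarrow> \<bar>g x - g y\<bar> \<le> e"
    using assms by (auto simp: ucont_def)
  then show ?thesis using that[of V] by (metis abs_minus_commute)
qed

text \<open>One finite set with one family of weights replaces \<phi> in the convolution and in both
  slots of the form. Both iterated integrals are compared with the same finite sum, and this is what
  allows the order of integration to be exchanged.\<close>

lemma conv_form_discretize:
  assumes g: "ucont g" "\<And>x. \<bar>g x\<bar> \<le> B" and even: "\<And>x. g (- x) = g x"
    and \<phi>: "test_fun \<phi>" and \<psi>: "integrable M \<psi>" and e: "0 < e"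
  obtains Z w where "finite Z" "(\<Sum>b\<in>Z. \<bar>w b\<bar>) \<le> (\<integral>x. \<bar>\<phi> x\<bar> \<partial>M)"
    "\<And>x. \<bar>conv g \<phi> x - (\<Sum>b\<in>Z. w b * g (b - x))\<bar> \<le> e * (\<integral>x. \<bar>\<phi> x\<bar> \<partial>M)"
    "\<bar>conv_form g \<phi> \<psi> - (\<Sum>b\<in>Z. w b * conv g \<psi> b)\<bar> \<le> e * (\<integral>x. \<bar>\<phi> x\<bar> \<partial>M) * (\<integral>x. \<bar>\<psi> x\<bar> \<partial>M)"
    "\<bar>conv_form g \<psi> \<phi> - (\<Sum>b\<in>Z. w b * conv g \<psi> b)\<bar> \<le> e * (\<integral>x. \<bar>\<phi> x\<bar> \<partial>M) * (\<integral>x. \<bar>\<psi> x\<bar> \<partial>M)"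
proof -
  obtain V where V: "open V" "0 \<in> V" "\<And>x y. x - y \<in> V \<Longrightarrow> \<bar>g x - g y\<bar> \<le> e" "\<And>x y. y - x \<in> V \<Longrightarrow> \<bar>g x - g y\<bar> \<le> e"
    using ucont_nbhd_symmetric[OF g(1) e] by blast
  note cg = ucont_continuous[OF g(1)]
  note i\<phi> = test_fun_integrable[OF \<phi>]
  define N where "N = (\<integral>x. \<bar>\<phi> x\<bar> \<partial>M)"
  obtain Z w where Z: "finite Z" "(\<Sum>b\<in>Z. \<bar>w b\<bar>) \<le> N"
    and w: "\<And>H B e. continuous_on UNIV H \<Longrightarrow> (\<And>x. \<bar>H x\<bar> \<le> B) \<Longrightarrow> (\<And>z b. z - b \<in> V \<Longrightarrow> \<bar>H z - H b\<bar> \<le> e) \<Longrightarrow>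
        \<bar>(\<integral>x. H x * \<phi> x \<partial>M) - (\<Sum>b\<in>Z. w b * H b)\<bar> \<le> e * N"
    using discretize[OF \<phi> V(1,2)] unfolding N_def by blast
  have 1: "\<bar>conv g \<phi> x - (\<Sum>b\<in>Z. w b * g (b - x))\<bar> \<le> e * N" for x
    unfolding conv_def by (rule w[OF continuous_translate[OF cg] g(2)]) (use V in auto)
  \<comment> \<open>By \<open>conv_modulus\<close>, \<open>conv g \<psi>\<close> obeys a modulus of
    continuity for the same \<open>V\<close>, so the weights already chosen apply to it as
    well.\<close>
  have "\<bar>(\<integral>y. conv g \<psi> y * \<phi> y \<partial>M) - (\<Sum>b\<in>Z. w b * conv g \<psi> b)\<bar> \<le> e * (\<integral>x. \<bar>\<psi> x\<bar> \<partial>M) * N"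
  proof (rule w)
    show "continuous_on UNIV (conv g \<psi>)" by (intro ucont_continuous conv_ucont[OF g \<psi>])
    show "\<bar>conv g \<psi> x\<bar> \<le> B * (\<integral>x. \<bar>\<psi> x\<bar> \<partial>M)" for x by (rule conv_bound[OF cg g(2) \<psi>])
    show "\<bar>conv g \<psi> z - conv g \<psi> b\<bar> \<le> e * (\<integral>x. \<bar>\<psi> x\<bar> \<partial>M)" if "z - b \<in> V" for z b
      using conv_modulus[OF cg g(2) \<psi>, of V e z b] conv_modulus[OF cg g(2) \<psi>, of V e b z] V(3) that
      by (simp add: abs_minus_commute)
  qed
  then have 3: "\<bar>conv_form g \<psi> \<phi> - (\<Sum>b\<in>Z. w b * conv g \<psi> b)\<bar> \<le> e * N * (\<integral>x. \<bar>\<psi> x\<bar> \<partial>M)"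
    unfolding conv_form_def by (simp add: mult_ac)
  have ev: "g (b - y) = g (y - b)" for b y using even[of "b - y"] by simp
  have iS: "integrable M (\<lambda>y. w b * (g (b - y) * \<psi> y))" for b
    using conv_integrable[OF cg g(2) \<psi>, of b] by (simp add: ev)
  have eqS: "(\<Sum>b\<in>Z. w b * g (b - y)) * \<psi> y = (\<Sum>b\<in>Z. w b * (g (b - y) * \<psi> y))" for y
    by (simp add: sum_distrib_right mult.assoc)
  \<comment> \<open>A finite sum commutes with the integral, and evenness turns
    \<open>g (b - y)\<close> into the kernel of \<open>conv g \<psi> b\<close>.\<close>
  have S: "(\<integral>y. (\<Sum>b\<in>Z. w b * g (b - y)) * \<psi> y \<partial>M) = (\<Sum>b\<in>Z. w b * conv g \<psi> b)"
    unfolding eqS by (subst Bochner_Integration.integral_sum) (use iS in \<open>auto simp: conv_def ev\<close>)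
  have "\<bar>\<integral>y. (conv g \<phi> y - (\<Sum>b\<in>Z. w b * g (b - y))) * \<psi> y \<partial>M\<bar> \<le> e * N * (\<integral>x. \<bar>\<psi> x\<bar> \<partial>M)"
  proof (rule integral_mult_le[OF _ \<psi> 1])
    show "integrable M (\<lambda>y. (conv g \<phi> y - (\<Sum>b\<in>Z. w b * g (b - y))) * \<psi> y)"
      unfolding left_diff_distrib eqS
      by (intro Bochner_Integration.integrable_diff conv_form_integrable[OF g i\<phi> \<psi>] Bochner_Integration.integrable_sum iS)
  qed
  moreover have "(\<integral>y. (conv g \<phi> y - (\<Sum>b\<in>Z. w b * g (b - y))) * \<psi> y \<partial>M) = conv_form g \<phi> \<psi> - (\<Sum>b\<in>Z. w b * conv g \<psi> b)"
    unfolding left_diff_distrib S[symmetric] unfolding eqS conv_form_def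
    by (intro Bochner_Integration.integral_diff conv_form_integrable[OF g i\<phi> \<psi>] Bochner_Integration.integrable_sum iS)
  ultimately show ?thesis using that[of Z w] Z 1 3 unfolding N_def by metis
qed

lemma conv_form_sym:
  assumes g: "ucont g" "\<And>x. \<bar>g x\<bar> \<le> B" and even: "\<And>x. g (- x) = g x"
    and \<phi>: "test_fun \<phi>" and \<psi>: "integrable M \<psi>"
  shows "conv_form g \<phi> \<psi> = conv_form g \<psi> \<phi>"
proof -
  define P where "P = (\<integral>x. \<bar>\<phi> x\<bar> \<partial>M) * (\<integral>x. \<bar>\<psi> x\<bar> \<partial>M)"
  have P: "0 \<le> P" unfolding P_def by (intro mult_nonneg_nonneg integral_abs_nonneg)
  have "\<bar>conv_form g \<phi> \<psi> - conv_form g \<psi> \<phi>\<bar> \<le> 0 + e" if e: "0 < e" for e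
  proof -
    define e' where "e' = e / (2 * P + 1)"
    have e': "0 < e'" "2 * (e' * P) \<le> e" using e P by (auto simp: e'_def field_simps)
    obtain Z w where "\<bar>conv_form g \<phi> \<psi> - (\<Sum>b\<in>Z. w b * conv g \<psi> b)\<bar> \<le> e' * (\<integral>x. \<bar>\<phi> x\<bar> \<partial>M) * (\<integral>x. \<bar>\<psi> x\<bar> \<partial>M)"
      "\<bar>conv_form g \<psi> \<phi> - (\<Sum>b\<in>Z. w b * conv g \<psi> b)\<bar> \<le> e' * (\<integral>x. \<bar>\<phi> x\<bar> \<partial>M) * (\<integral>x. \<bar>\<psi> x\<bar> \<partial>M)"
      by (rule conv_form_discretize[OF g even \<phi> \<psi> e'(1)])
    then have "\<bar>conv_form g \<phi> \<psi> - conv_form g \<psi> \<phi>\<bar> \<le> 2 * (e' * P)"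
      unfolding mult.assoc P_def[symmetric] by linarith
    with e'(2) show ?thesis by linarith
  qed
  then have "\<bar>conv_form g \<phi> \<psi> - conv_form g \<psi> \<phi>\<bar> \<le> 0" by (rule field_le_epsilon)
  then show ?thesis by simp
qed

text \<open>The integral version of \<open>positive_definite_sum_square_le\<close>, obtained from it
  by replacing \<phi> with finitely many weighted points. In particular the form is nonnegative on
  the diagonal.\<close>

lemma conv_square_le:
  assumes pd: "positive_definite g" and g0: "g 0 = 1" and g: "ucont g" and \<phi>: "test_fun \<phi>"
  shows "(conv g \<phi> x)\<^sup>2 \<le> conv_form g \<phi> \<phi>"
proof (rule field_le_epsilon)
  fix e :: real assume e: "0 < e"
  note b = positive_definite_abs_le_1[OF pd g0]
  define N where "N = (\<integral>x. \<bar>\<phi> x\<bar> \<partial>M)"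
  have N: "0 \<le> N" unfolding N_def by (rule integral_abs_nonneg)
  \<comment> \<open>The factor 4 adds up two errors: \<open>R\<close> differs from the form by two
    discretisations of cost \<open>e' * N\<^sup>2\<close> each, and passing from
    \<open>S\<^sup>2\<close> to the squared convolution costs \<open>e' * N\<close> times
    \<open>2 * N\<close>.\<close>
  define e' where "e' = e / (4 * N\<^sup>2 + 1)"
  have e': "0 < e'" "4 * (e' * N\<^sup>2) \<le> e" using e by (auto simp: e'_def field_simps add_pos_nonneg)
  obtain Z w where Z: "finite Z" "(\<Sum>b\<in>Z. \<bar>w b\<bar>) \<le> (\<integral>x. \<bar>\<phi> x\<bar> \<partial>M)"
    and w: "\<And>x. \<bar>conv g \<phi> x - (\<Sum>b\<in>Z. w b * g (b - x))\<bar> \<le> e' * (\<integral>x. \<bar>\<phi> x\<bar> \<partial>M)"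
    "\<bar>conv_form g \<phi> \<phi> - (\<Sum>b\<in>Z. w b * conv g \<phi> b)\<bar> \<le> e' * (\<integral>x. \<bar>\<phi> x\<bar> \<partial>M) * (\<integral>x. \<bar>\<phi> x\<bar> \<partial>M)"
    by (rule conv_form_discretize[OF g b positive_definite_even[OF pd] \<phi> test_fun_integrable[OF \<phi>] e'(1)]) (rule that)
  note Z = Z[folded N_def] and w = w[folded N_def]
  define S where "S = (\<Sum>b\<in>Z. w b * g (b - x))"
  define R where "R = (\<Sum>a\<in>Z. \<Sum>b\<in>Z. w a * w b * g (a - b))"
  have SR: "S\<^sup>2 \<le> R" unfolding S_def R_def by (rule positive_definite_sum_square_le[OF pd g0 Z(1)])
  have ev: "g (a - b) = g (b - a)" for a b using positive_definite_even[OF pd, of "a - b"] by simp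
  have "(\<Sum>b\<in>Z. w b * conv g \<phi> b) - R = (\<Sum>a\<in>Z. w a * (conv g \<phi> a - (\<Sum>b\<in>Z. w b * g (b - a))))"
    by (simp add: R_def right_diff_distrib sum_subtractf sum_distrib_left mult.assoc ev)
  also have "\<bar>\<dots>\<bar> \<le> (\<Sum>a\<in>Z. \<bar>w a\<bar> * (e' * N))"
    by (rule order_trans[OF sum_abs]) (auto simp: abs_mult intro!: sum_mono mult_left_mono w)
  also have "\<dots> \<le> N * (e' * N)" unfolding sum_distrib_right[symmetric]
    using Z(2) e'(1) N by (intro mult_right_mono) auto
  finally have R: "R \<le> conv_form g \<phi> \<phi> + 2 * (e' * N\<^sup>2)" using w(2) by (simp add: power2_eq_square mult_ac)
  have "\<bar>S\<bar> \<le> (\<Sum>b\<in>Z. \<bar>w b\<bar>)" unfolding S_def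
    by (rule order_trans[OF sum_abs]) (auto simp: abs_mult intro!: sum_mono mult_left_le b)
  with Z have "\<bar>S\<bar> \<le> N" by linarith
  moreover have "\<bar>conv g \<phi> x\<bar> \<le> N"
    using conv_bound[OF ucont_continuous[OF g] b test_fun_integrable[OF \<phi>], of x] by (simp add: N_def)
  ultimately have "\<bar>conv g \<phi> x + S\<bar> \<le> 2 * N" by linarith
  with w(1)[of x, folded S_def] have "\<bar>conv g \<phi> x - S\<bar> * \<bar>conv g \<phi> x + S\<bar> \<le> (e' * N) * (2 * N)"
    using N e' by (intro mult_mono) auto
  then have "\<bar>(conv g \<phi> x)\<^sup>2 - S\<^sup>2\<bar> \<le> 2 * (e' * N\<^sup>2)"
    by (simp add: abs_mult[symmetric] power2_eq_square algebra_simps)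
  with SR R e'(2) show "(conv g \<phi> x)\<^sup>2 \<le> conv_form g \<phi> \<phi> + e" by linarith
qed

lemma ucont_uniform_approx:
  assumes "\<And>e. 0 < e \<Longrightarrow> \<exists>f. ucont f \<and> (\<forall>x. \<bar>f x - h x\<bar> \<le> e)"
  shows "ucont (h :: 'a \<Rightarrow> real)"
  unfolding ucont_def
proof (intro allI impI)
  fix e :: real assume e: "0 < e"
  then obtain f where f: "ucont f" "\<And>x. \<bar>f x - h x\<bar> \<le> e / 3" using assms[of "e / 3"] by auto
  obtain V where V: "open V" "0 \<in> V" "\<And>x y. x - y \<in> V \<Longrightarrow> \<bar>f x - f y\<bar> \<le> e / 3"
    using f(1)[unfolded ucont_def, rule_format, of "e / 3"] e by auto
  show "\<exists>V. open V \<and> 0 \<in> V \<and> (\<forall>x y. x - y \<in> V \<longrightarrow> \<bar>h x - h y\<bar> \<le> e)"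
  proof (intro exI[of _ V] conjI V allI impI)
    fix x y assume "x - y \<in> V"
    from V(3)[OF this] f(2)[of x] f(2)[of y] show "\<bar>h x - h y\<bar> \<le> e" by linarith
  qed
qed

lemma test_fun_linear:
  assumes "test_fun \<phi>" "test_fun \<psi>"
  shows "test_fun (\<lambda>x. a * \<phi> x + b * \<psi> x)"
proof -
  obtain K L where K: "compact K" "\<forall>x. x \<notin> K \<longrightarrow> \<phi> x = 0" and L: "compact L" "\<forall>x. x \<notin> L \<longrightarrow> \<psi> x = 0"
    using assms by (auto simp: test_fun_def)
  have i: "integrable M \<phi>" "integrable M \<psi>" "integrable M (\<lambda>x. (\<phi> x)\<^sup>2)" "integrable M (\<lambda>x. (\<psi> x)\<^sup>2)"
    using assms by (auto simp: test_fun_def)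
  have p: "integrable M (\<lambda>x. \<phi> x * \<psi> x)"
    using i by (intro integral_Cauchy_Schwarz(1)) auto
  have eq: "(a * \<phi> x + b * \<psi> x)\<^sup>2 = a\<^sup>2 * (\<phi> x)\<^sup>2 + 2 * a * b * (\<phi> x * \<psi> x) + b\<^sup>2 * (\<psi> x)\<^sup>2" for x
    by (simp add: power2_eq_square algebra_simps)
  show ?thesis
    unfolding test_fun_def eq using i p K L
    by (auto intro!: exI[of _ "K \<union> L"] compact_Un)
qed

text \<open>After discretisation this is Cauchy-Schwarz on \<open>A\<close> for each translate of u.
  The point of the bound is that \<phi> enters only through its L^1 norm: the densities used later
  have L^1 norm 1, while their L^2 norms may grow without bound.\<close>

lemma conv_L1_bound:
  assumes u: "ucont u" "\<And>x. \<bar>u x\<bar> \<le> B" "\<And>x. u (- x) = u x" "integrable M (\<lambda>x. (u x)\<^sup>2)"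
    and \<phi>: "test_fun \<phi>" and A: "A \<in> sets M" "emeasure M A < \<infinity>"
  shows "(\<integral>x. indicator A x * \<bar>conv u \<phi> x\<bar> \<partial>M) \<le> (\<integral>x. \<bar>\<phi> x\<bar> \<partial>M) * sqrt (measure M A * (\<integral>x. (u x)\<^sup>2 \<partial>M))"
proof (rule field_le_epsilon)
  fix e :: real assume e: "0 < e"
  define N where "N = (\<integral>x. \<bar>\<phi> x\<bar> \<partial>M)"
  have N: "0 \<le> N" unfolding N_def by (rule integral_abs_nonneg)
  define s where "s = sqrt (measure M A * (\<integral>x. (u x)\<^sup>2 \<partial>M))"
  have s: "0 \<le> s" unfolding s_def by (intro real_sqrt_ge_zero mult_nonneg_nonneg Bochner_Integration.integral_nonneg) auto
  define e' where "e' = e / (N * measure M A + 1)"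
  have e': "0 < e'" "e' * N * measure M A \<le> e" using e N 
  proof -
    have "0 \<le> N * measure M A" using N by simp
    with e show "0 < e'" "e' * N * measure M A \<le> e" by (auto simp: e'_def field_simps)
  qed
  note i = test_fun_integrable[OF \<phi>]
  obtain Z w where Z: "finite Z" "(\<Sum>b\<in>Z. \<bar>w b\<bar>) \<le> (\<integral>x. \<bar>\<phi> x\<bar> \<partial>M)"
    and w: "\<And>x. \<bar>conv u \<phi> x - (\<Sum>b\<in>Z. w b * u (b - x))\<bar> \<le> e' * (\<integral>x. \<bar>\<phi> x\<bar> \<partial>M)"
    by (rule conv_form_discretize[OF u(1-3) \<phi> i e'(1)]) (rule that)
  note Z = Z[folded N_def] and w = w[folded N_def]
  have ev: "u (b - x) = u (x - b)" for b x using u(3)[of "b - x"] by simp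
  note cu = ucont_continuous[OF u(1)]
  have iA: "integrable M (indicator A :: 'a \<Rightarrow> real)" using A by (simp add: integrable_indicator_iff)
  have mu: "u \<in> borel_measurable M" by (rule measurable_continuous[OF cu])
  have mu2: "(\<lambda>x. (u x)\<^sup>2) \<in> borel_measurable M" using mu by measurable
  have mub: "(\<lambda>x. u (x - b)) \<in> borel_measurable M" for b by (intro measurable_continuous continuous_translate cu)
  have one: "integrable M (\<lambda>x. indicator A x * \<bar>u (x - b)\<bar>)"
    "(\<integral>x. indicator A x * \<bar>u (x - b)\<bar> \<partial>M) \<le> s" for b
  proof -
    have a: "integrable M (\<lambda>x. (\<bar>u (x - b)\<bar>)\<^sup>2)" using integral_translate(2)[OF mu2, of b] u(4) by simp
    have c: "integrable M (\<lambda>x. (indicator A x :: real)\<^sup>2)" using iA by (simp add: power2_eq_square indicator_inter_arith[symmetric])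
    have m: "(indicator A :: 'a \<Rightarrow> real) \<in> borel_measurable M" "(\<lambda>x. \<bar>u (x - b)\<bar>) \<in> borel_measurable M"
      using A mub[of b] by auto
    have "(\<integral>x. (indicator A x :: real)\<^sup>2 \<partial>M) = measure M A"
      using A by (simp add: power2_eq_square indicator_inter_arith[symmetric] sets.Int_space_eq2)
    moreover have "(\<integral>x. (\<bar>u (x - b)\<bar>)\<^sup>2 \<partial>M) = (\<integral>x. (u x)\<^sup>2 \<partial>M)"
      using integral_translate(1)[OF mu2, of b] by simp
    ultimately show "integrable M (\<lambda>x. indicator A x * \<bar>u (x - b)\<bar>)"
      "(\<integral>x. indicator A x * \<bar>u (x - b)\<bar> \<partial>M) \<le> s"
      using integral_Cauchy_Schwarz[OF m c a] by (auto simp: s_def)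
  qed
  have "(\<integral>x. indicator A x * \<bar>conv u \<phi> x\<bar> \<partial>M) \<le>
      (\<integral>x. (\<Sum>b\<in>Z. \<bar>w b\<bar> * (indicator A x * \<bar>u (x - b)\<bar>)) + e' * N * indicator A x \<partial>M)"
  proof (rule integral_mono)
    have "integrable M (\<lambda>x. \<bar>conv u \<phi> x\<bar> * indicator A x)"
      using iA cu by (intro integrable_mult_bounded[where B = "B * N"] measurable_continuous continuous_on_rabs ucont_continuous conv_ucont[OF u(1,2) i])
        (use conv_bound[OF cu u(2) i] in \<open>auto simp: N_def\<close>)
    then show "integrable M (\<lambda>x. indicator A x * \<bar>conv u \<phi> x\<bar>)" by (simp add: mult.commute)
    show "integrable M (\<lambda>x. (\<Sum>b\<in>Z. \<bar>w b\<bar> * (indicator A x * \<bar>u (x - b)\<bar>)) + e' * N * indicator A x)"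
      by (intro Bochner_Integration.integrable_add Bochner_Integration.integrable_sum integrable_mult_right one(1) iA)
    fix x
    have "\<bar>\<Sum>b\<in>Z. w b * u (b - x)\<bar> \<le> (\<Sum>b\<in>Z. \<bar>w b\<bar> * \<bar>u (x - b)\<bar>)"
      by (rule order_trans[OF sum_abs]) (simp add: abs_mult ev)
    with w[of x] have "\<bar>conv u \<phi> x\<bar> \<le> (\<Sum>b\<in>Z. \<bar>w b\<bar> * \<bar>u (x - b)\<bar>) + e' * N" by linarith
    then show "indicator A x * \<bar>conv u \<phi> x\<bar> \<le> (\<Sum>b\<in>Z. \<bar>w b\<bar> * (indicator A x * \<bar>u (x - b)\<bar>)) + e' * N * indicator A x"
      by (auto simp: indicator_def)
  qed
  also have "\<dots> = (\<Sum>b\<in>Z. \<bar>w b\<bar> * (\<integral>x. indicator A x * \<bar>u (x - b)\<bar> \<partial>M)) + e' * N * measure M A"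
    using one(1) iA A by (simp add: Bochner_Integration.integral_sum sets.Int_space_eq2)
  also have "\<dots> \<le> (\<Sum>b\<in>Z. \<bar>w b\<bar>) * s + e"
    unfolding sum_distrib_right using e'(2) by (intro add_mono sum_mono mult_left_mono one(2)) auto
  also have "\<dots> \<le> N * s + e" using Z(2) s by (simp add: mult_right_mono)
  finally show "(\<integral>x. indicator A x * \<bar>conv u \<phi> x\<bar> \<partial>M) \<le> (\<integral>x. \<bar>\<phi> x\<bar> \<partial>M) * sqrt (measure M A * (\<integral>x. (u x)\<^sup>2 \<partial>M)) + e"
    by (simp add: N_def s_def)
qed

section \<open>Probability densities, indicators of translates, double averages\<close>

definition densities :: "'a set \<Rightarrow> ('a \<Rightarrow> real) set" where
  "densities V = {\<phi>. test_fun \<phi> \<and> (\<forall>x. 0 \<le> \<phi> x) \<and> (\<forall>x. x \<notin> V \<longrightarrow> \<phi> x = 0) \<and> (\<integral>x. \<phi> x \<partial>M) = 1}"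

lemma densities_mono: "V \<subseteq> W \<Longrightarrow> densities V \<subseteq> densities W"
  by (auto simp: densities_def)

lemma densities_integral_abs: "\<phi> \<in> densities V \<Longrightarrow> (\<integral>x. \<bar>\<phi> x\<bar> \<partial>M) = 1"
  by (simp add: densities_def)

lemma compact_nbhd:
  obtains U K where "open U" "(0::'a) \<in> U" "compact K" "U \<subseteq> K"
  using lca unfolding lca_group_def by blast

lemma test_fun_indicator:
  assumes V: "open V" "V \<subseteq> K" "compact K"
  shows "test_fun (indicator {x. x - a \<in> V})"
    and "(\<integral>x. indicator {x. x - a \<in> V} x \<partial>M) = measure M V"
    and "emeasure M V < \<infinity>"
proof -
  have m: "{x. x - a \<in> V} \<in> sets M" using open_vimage_diff_left[OF V(1)] by (simp add: sets_M)
  have eq: "emeasure M {x. x - a \<in> V} = emeasure M V"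
    using emeasure_translate[of V a] V(1) by (simp add: translate_image)
  have "emeasure M V \<le> emeasure M K" using V by (intro emeasure_mono) (auto simp: sets_M compact_imp_closed)
  then show f: "emeasure M V < \<infinity>" using emeasure_compact[OF V(3)] by (rule le_less_trans)
  have i: "integrable M (indicator {x. x - a \<in> V} :: 'a \<Rightarrow> real)"
    using m eq f by (simp add: integrable_indicator_iff)
  have K: "compact {x. x - a \<in> K}" using compact_translate[OF V(3), of a] by (simp add: translate_image)
  have sq: "(\<lambda>x. (indicator {x. x - a \<in> V} x :: real)\<^sup>2) = indicator {x. x - a \<in> V}"
    by (auto simp: indicator_def)
  show "test_fun (indicator {x. x - a \<in> V})"
    unfolding test_fun_def sq using i K V(2)
    by (auto intro!: exI[of _ "{x. x - a \<in> K}"] simp: indicator_def)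
  show "(\<integral>x. indicator {x. x - a \<in> V} x \<partial>M) = measure M V"
    using m eq by (simp add: measure_def sets.Int_space_eq2)
qed

lemma densities_nonempty:
  assumes "open V" "0 \<in> V"
  shows "densities V \<noteq> {}"
proof -
  obtain U K where U: "open U" "(0::'a) \<in> U" "compact K" "U \<subseteq> K" by (rule compact_nbhd)
  define W where "W = V \<inter> U"
  have W: "open W" "W \<subseteq> K" "W \<noteq> {}" using assms U by (auto simp: W_def)
  note t = test_fun_indicator(1,2)[OF W(1,2) U(3), of 0, simplified] test_fun_indicator(3)[OF W(1,2) U(3)]
  have pos: "0 < measure M W" using W(1,3) t(3) by (rule measure_open_pos)
  \<comment> \<open>The normalised indicator of \<open>W\<close>; the vanishing second summand gives
    it the shape that \<open>test_fun_linear\<close> expects.\<close>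
  have "(\<lambda>x. (1 / measure M W) * indicator W x + 0 * indicator W x) \<in> densities V"
    unfolding densities_def
  proof (intro CollectI conjI allI impI)
    show "test_fun (\<lambda>x. (1 / measure M W) * indicator W x + 0 * indicator W x)"
      by (rule test_fun_linear[OF t(1) t(1)])
    show "(\<integral>x. (1 / measure M W) * indicator W x + 0 * indicator W x \<partial>M) = 1"
      using t(2) pos by simp
  qed (use pos in \<open>auto simp: W_def\<close>)
  then show ?thesis by blast
qed

text \<open>Convergence in L^1 says nothing about single values, but it does control double averages
  over \<open>b + V\<close> and \<open>a + V\<close>. For a continuous function these recover the
  value at \<open>b - a\<close>, since \<open>(z - y) - (b - a) = (z - b) - (y - a)\<close> is a
  difference of two elements of \<open>V\<close>.\<close>

lemma conv_form_indicator_approx: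
  assumes h: "ucont h" "\<And>x. \<bar>h x\<bar> \<le> B" and V: "open V" "V \<subseteq> K" "compact K"
    and osc: "\<forall>x y. \<forall>v\<in>V. \<forall>w\<in>V. x - y = v - w \<longrightarrow> \<bar>h x - h y\<bar> \<le> e"
  shows "\<bar>conv_form h (indicator {x. x - b \<in> V}) (indicator {x. x - a \<in> V}) - h (b - a) * (measure M V)\<^sup>2\<bar> \<le> e * (measure M V)\<^sup>2"
proof -
  define \<phi> :: "'a \<Rightarrow> real" where "\<phi> = indicator {x. x - b \<in> V}"
  define \<psi> :: "'a \<Rightarrow> real" where "\<psi> = indicator {x. x - a \<in> V}"
  define v where "v = measure M V"
  have i: "integrable M \<phi>" "integrable M \<psi>"
    using test_fun_indicator(1)[OF V] by (auto simp: \<phi>_def \<psi>_def intro: test_fun_integrable)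
  have n: "(\<integral>x. \<phi> x \<partial>M) = v" "(\<integral>x. \<bar>\<phi> x\<bar> \<partial>M) = v" "(\<integral>x. \<psi> x \<partial>M) = v" "(\<integral>x. \<bar>\<psi> x\<bar> \<partial>M) = v"
    using test_fun_indicator(2)[OF V] by (simp_all add: \<phi>_def \<psi>_def v_def)
  note ch = ucont_continuous[OF h(1)]
  have inner: "\<bar>conv h \<phi> y - h (b - a) * v\<bar> \<le> e * v" if y: "\<psi> y \<noteq> 0" for y
  proof -
    have ic: "integrable M (\<lambda>z. h (z - y) * \<phi> z)" by (rule conv_integrable[OF ch h(2) i(1)])
    have "conv h \<phi> y - h (b - a) * v = (\<integral>z. (h (z - y) - h (b - a)) * \<phi> z \<partial>M)"
      using ic i(1) by (simp add: conv_def left_diff_distrib n)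
    also have "\<bar>\<dots>\<bar> \<le> e * (\<integral>x. \<bar>\<phi> x\<bar> \<partial>M)"
    proof (rule integral_mult_le[OF _ i(1)])
      show "integrable M (\<lambda>z. (h (z - y) - h (b - a)) * \<phi> z)" using ic i(1) by (simp add: left_diff_distrib)
      fix z assume "\<phi> z \<noteq> 0"
      then have "z - b \<in> V" "y - a \<in> V" using y by (auto simp: \<phi>_def \<psi>_def indicator_def split: if_splits)
      moreover have "(z - y) - (b - a) = (z - b) - (y - a)" by simp
      ultimately show "\<bar>h (z - y) - h (b - a)\<bar> \<le> e" using osc by blast
    qed
    finally show ?thesis by (simp add: n)
  qed
  have icf: "integrable M (\<lambda>y. conv h \<phi> y * \<psi> y)" by (rule conv_form_integrable[OF h i])
  have "conv_form h \<phi> \<psi> - h (b - a) * v * v = (\<integral>y. (conv h \<phi> y - h (b - a) * v) * \<psi> y \<partial>M)"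
    using icf i(2) by (simp add: conv_form_def left_diff_distrib n)
  also have "\<bar>\<dots>\<bar> \<le> e * v * (\<integral>x. \<bar>\<psi> x\<bar> \<partial>M)"
    by (rule integral_mult_le[OF _ i(2) inner]) (use icf i(2) in \<open>simp_all add: left_diff_distrib\<close>)
  finally have "\<bar>conv_form h \<phi> \<psi> - h (b - a) * v * v\<bar> \<le> e * v * v" by (simp only: n(4))
  then show ?thesis by (simp add: \<phi>_def \<psi>_def v_def power2_eq_square mult.assoc)
qed

lemma conv_sum:
  assumes "continuous_on UNIV g" "\<And>x. \<bar>g x\<bar> \<le> B" "\<And>i. i \<in> I \<Longrightarrow> integrable M (\<phi> i)"
  shows "conv g (\<lambda>x. \<Sum>i\<in>I. c i * \<phi> i x) x = (\<Sum>i\<in>I. c i * conv g (\<phi> i) x)"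
proof -
  have eq: "g (z - x) * (\<Sum>i\<in>I. c i * \<phi> i z) = (\<Sum>i\<in>I. c i * (g (z - x) * \<phi> i z))" for z
    by (simp add: sum_distrib_left mult_ac)
  show ?thesis unfolding conv_def eq
    by (subst Bochner_Integration.integral_sum) (use conv_integrable[OF assms] in auto)
qed

lemma conv_form_sum:
  assumes "ucont g" "\<And>x. \<bar>g x\<bar> \<le> B" "\<And>i. i \<in> I \<Longrightarrow> integrable M (\<phi> i)"
  shows "conv_form g (\<lambda>x. \<Sum>i\<in>I. c i * \<phi> i x) (\<lambda>x. \<Sum>i\<in>I. c i * \<phi> i x) =
    (\<Sum>i\<in>I. \<Sum>j\<in>I. c i * c j * conv_form g (\<phi> i) (\<phi> j))"
proof -
  have eq: "conv g (\<lambda>x. \<Sum>i\<in>I. c i * \<phi> i x) y * (\<Sum>i\<in>I. c i * \<phi> i y) =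
      (\<Sum>i\<in>I. \<Sum>j\<in>I. c i * c j * (conv g (\<phi> i) y * \<phi> j y))" for y
    by (subst conv_sum[OF ucont_continuous[OF assms(1)] assms(2,3)], assumption)
       (unfold sum_product, intro sum.cong refl, simp add: mult_ac)
  show ?thesis unfolding conv_form_def eq
    using conv_form_integrable[OF assms(1,2,3,3)]
    by (subst Bochner_Integration.integral_sum)
       (auto intro!: Bochner_Integration.integrable_sum sum.cong simp: Bochner_Integration.integral_sum)
qed

lemma test_fun_sum:
  assumes "finite I" "\<And>i. i \<in> I \<Longrightarrow> test_fun (\<phi> i)"
  shows "test_fun (\<lambda>x. \<Sum>i\<in>I. c i * \<phi> i x)"
  using assms
proof (induction I rule: finite_induct)
  case empty
  then show ?case by (auto simp: test_fun_def intro!: exI[of _ "{}"])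
next
  case (insert i I)
  then have "test_fun (\<lambda>x. c i * \<phi> i x + 1 * (\<Sum>i\<in>I. c i * \<phi> i x))"
    by (intro test_fun_linear) auto
  then show ?case using insert.hyps by simp
qed

lemma emeasure_vimage_translate:
  assumes "A \<in> sets M"
  shows "{x. x - a \<in> A} \<in> sets M" and "emeasure M {x. x - a \<in> A} = emeasure M A"
proof -
  have "(\<lambda>x. x - a) -` A \<inter> space M \<in> sets M" using measurable_sets[OF measurable_diff_left' assms] .
  then show "{x. x - a \<in> A} \<in> sets M" by (simp add: vimage_def)
  show "emeasure M {x. x - a \<in> A} = emeasure M A"
    using emeasure_translate[of A a] assms by (simp add: translate_image sets_M)
qed

text \<open>Collects what double averaging needs: h oscillates little along differences of elements
  of \<open>V\<close>, and these differences stay in an open set \<open>W\<close> inside a compact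
  set, so that only a region of finite measure is involved.\<close>

lemma small_nbhd:
  assumes "ucont (h :: 'a \<Rightarrow> real)" "0 < e"
  obtains V W K where "open V" "0 \<in> V" "V \<subseteq> K" "open W" "W \<subseteq> K" "compact K"
    "\<And>v w. v \<in> V \<Longrightarrow> w \<in> V \<Longrightarrow> v - w \<in> W"
    "\<forall>x y. \<forall>v\<in>V. \<forall>w\<in>V. x - y = v - w \<longrightarrow> \<bar>h x - h y\<bar> \<le> e"
proof -
  obtain O1 where O1: "open O1" "0 \<in> O1" "\<And>x y. x - y \<in> O1 \<Longrightarrow> \<bar>h x - h y\<bar> \<le> e"
    using assms by (auto simp: ucont_def)
  obtain U K where U: "open U" "(0::'a) \<in> U" "compact K" "U \<subseteq> K" by (rule compact_nbhd)
  obtain V where V: "open V" "0 \<in> V" "\<forall>x\<in>V. \<forall>y\<in>V. x - y \<in> O1 \<inter> U"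
    using nbhd_diff[of "O1 \<inter> U"] O1 U by auto
  show ?thesis
  proof (rule that[of "V \<inter> U" K "O1 \<inter> U"])
    show "\<forall>x y. \<forall>v\<in>V \<inter> U. \<forall>w\<in>V \<inter> U. x - y = v - w \<longrightarrow> \<bar>h x - h y\<bar> \<le> e"
    proof (intro allI ballI impI)
      fix x y v w assume "x - y = v - w" "v \<in> V \<inter> U" "w \<in> V \<inter> U"
      then have "x - y \<in> O1" using V(3) by auto
      then show "\<bar>h x - h y\<bar> \<le> e" by (rule O1(3))
    qed
  qed (use U O1 V in auto)
qed

end

section \<open>Limits of \<open>L\<^sup>2\<close>-Cauchy sequences of positive definite functions\<close>

locale pd_L2_Cauchy = haar_group +
  fixes g :: "nat \<Rightarrow> 'a::{ab_group_add, t2_space} \<Rightarrow> real"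
  assumes P1: "\<And>n. g n \<in> P1" and integrable: "\<And>n. integrable M (g n)"
    and Cauchy: "\<And>e. 0 < e \<Longrightarrow> \<exists>N. \<forall>m\<ge>N. \<forall>n\<ge>N. (\<integral>x. (g m x - g n x)\<^sup>2 \<partial>M) < e"
begin

lemma pd: "positive_definite (g n)" and at_0: "g n 0 = 1"
  using P1[of n] by (auto simp: P1_def)

lemma ucont: "ucont (g n)"
  by (rule P1_ucont[OF P1])

lemma continuous: "continuous_on UNIV (g n)"
  by (rule ucont_continuous[OF ucont])

lemma bound: "\<bar>g n x\<bar> \<le> 1"
  by (rule positive_definite_abs_le_1[OF pd at_0])

lemma even: "g n (- x) = g n x"
  by (rule positive_definite_even[OF pd])

lemma diff_ucont: "ucont (\<lambda>x. g m x - g n x)"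
  by (intro ucont_diff ucont)

lemma diff_bound: "\<bar>g m x - g n x\<bar> \<le> 2"
  using bound[of m x] bound[of n x] by linarith

lemma diff_square_integrable: "integrable M (\<lambda>x. (g m x - g n x)\<^sup>2)"
  unfolding power2_eq_square
  by (intro integrable_mult_bounded[where B = 2] measurable_continuous ucont_continuous diff_ucont
      diff_bound Bochner_Integration.integrable_diff integrable)

lemma conv_diff:
  assumes "integrable M \<phi>"
  shows "conv (\<lambda>x. g m x - g n x) \<phi> x = conv (g m) \<phi> x - conv (g n) \<phi> x"
  using conv_integrable[OF continuous bound assms]
  by (simp add: conv_def left_diff_distrib)

text \<open>Cauchy-Schwarz; translation invariance makes the bound independent of x. For a fixed
  test function it turns the L^2 Cauchy condition into a uniform one.\<close>

lemma conv_sup_bound: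
  assumes "test_fun \<phi>"
  shows "\<bar>conv (g m) \<phi> x - conv (g n) \<phi> x\<bar> \<le> sqrt ((\<integral>x. (g m x - g n x)\<^sup>2 \<partial>M) * (\<integral>x. (\<phi> x)\<^sup>2 \<partial>M))"
proof -
  define u where "u x = g m x - g n x" for x
  have cu: "continuous_on UNIV u" using ucont_continuous[OF diff_ucont[of m n]] by (simp add: u_def[abs_def])
  have mu2: "(\<lambda>x. (u x)\<^sup>2) \<in> borel_measurable M" using measurable_continuous[OF cu] by measurable
  have sq: "integrable M (\<lambda>z. (u (z - x))\<^sup>2)" "(\<integral>z. (u (z - x))\<^sup>2 \<partial>M) = (\<integral>z. (u z)\<^sup>2 \<partial>M)"
    using integral_translate[OF mu2, of x] diff_square_integrable[of m n] by (simp_all add: u_def)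
  have "\<bar>conv u \<phi> x\<bar> \<le> sqrt ((\<integral>z. (u (z - x))\<^sup>2 \<partial>M) * (\<integral>z. (\<phi> z)\<^sup>2 \<partial>M))"
    unfolding conv_def using assms
    by (intro integral_Cauchy_Schwarz(2) sq measurable_continuous[OF continuous_translate[OF cu]]) (auto simp: test_fun_def)
  then show ?thesis
    using conv_diff[OF test_fun_integrable[OF assms], of m n x] unfolding sq(2) unfolding u_def[abs_def] by simp
qed

text \<open>Morally the convolution of \<phi> with the L^2 limit of \<open>g n\<close>, which is
  itself never formed. The limit exists, uniformly, by \<open>uniform_limit_conv\<close>.\<close>

definition limit_conv :: "('a \<Rightarrow> real) \<Rightarrow> 'a \<Rightarrow> real" where
  "limit_conv \<phi> x = lim (\<lambda>n. conv (g n) \<phi> x)"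

lemma uniform_limit_conv:
  assumes "test_fun \<phi>"
  shows "uniform_limit UNIV (\<lambda>n. conv (g n) \<phi>) (limit_conv \<phi>) sequentially"
proof -
  define P where "P = (\<integral>x. (\<phi> x)\<^sup>2 \<partial>M)"
  have P: "0 \<le> P" unfolding P_def by (rule Bochner_Integration.integral_nonneg) simp
  have "uniformly_Cauchy_on UNIV (\<lambda>n. conv (g n) \<phi>)"
    unfolding uniformly_Cauchy_on_def
  proof (intro allI impI)
    fix e :: real assume e: "0 < e"
    then have "0 < e\<^sup>2 / (P + 1)" using P by simp
    from Cauchy[OF this] obtain N where N: "\<And>m n. m \<ge> N \<Longrightarrow> n \<ge> N \<Longrightarrow> (\<integral>x. (g m x - g n x)\<^sup>2 \<partial>M) < e\<^sup>2 / (P + 1)"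
      by blast
    show "\<exists>N. \<forall>x\<in>UNIV. \<forall>m\<ge>N. \<forall>n\<ge>N. dist (conv (g m) \<phi> x) (conv (g n) \<phi> x) < e"
    proof (intro exI[of _ N] ballI allI impI)
      fix x m n assume mn: "N \<le> m" "N \<le> n"
      have "(\<integral>x. (g m x - g n x)\<^sup>2 \<partial>M) * P \<le> e\<^sup>2 / (P + 1) * P"
        using N[OF mn] P by (intro mult_right_mono) auto
      also have "\<dots> < e\<^sup>2" using P e by (simp add: field_simps add_nonneg_pos)
      finally have "sqrt ((\<integral>x. (g m x - g n x)\<^sup>2 \<partial>M) * P) < e"
        using e by (simp add: real_less_lsqrt)
      with conv_sup_bound[OF assms, of m x n, folded P_def] show "dist (conv (g m) \<phi> x) (conv (g n) \<phi> x) < e"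
        by (simp add: dist_real_def)
    qed
  qed
  then have "uniformly_convergent_on UNIV (\<lambda>n. conv (g n) \<phi>)" by (rule Cauchy_uniformly_convergent)
  then show ?thesis by (simp add: uniformly_convergent_uniform_limit_iff limit_conv_def[abs_def])
qed

lemma limit_conv_approx:
  assumes "test_fun \<phi>" "0 < e"
  shows "\<exists>N. \<forall>n\<ge>N. \<forall>x. \<bar>conv (g n) \<phi> x - limit_conv \<phi> x\<bar> < e"
  using uniform_limitD[OF uniform_limit_conv[OF assms(1)] assms(2)]
  by (simp add: eventually_sequentially dist_real_def)

lemma tendsto_limit_conv:
  assumes "test_fun \<phi>"
  shows "(\<lambda>n. conv (g n) \<phi> x) \<longlonglongrightarrow> limit_conv \<phi> x"
  using tendsto_uniform_limitI[OF uniform_limit_conv[OF assms]] by simp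

lemma limit_conv_ucont:
  assumes "test_fun \<phi>"
  shows "ucont (limit_conv \<phi>)"
proof (rule ucont_uniform_approx)
  fix e :: real assume "0 < e"
  then obtain N where "\<forall>n\<ge>N. \<forall>x. \<bar>conv (g n) \<phi> x - limit_conv \<phi> x\<bar> < e" using limit_conv_approx[OF assms] by blast
  then show "\<exists>f. ucont f \<and> (\<forall>x. \<bar>f x - limit_conv \<phi> x\<bar> \<le> e)"
    using conv_ucont[OF ucont bound test_fun_integrable[OF assms], of N] by (force intro: less_imp_le)
qed

lemma limit_conv_bound:
  assumes "test_fun \<phi>"
  shows "\<bar>limit_conv \<phi> x\<bar> \<le> (\<integral>x. \<bar>\<phi> x\<bar> \<partial>M)"
proof (rule LIMSEQ_le_const2[OF tendsto_rabs[OF tendsto_limit_conv[OF assms]]])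
  show "\<exists>N. \<forall>n\<ge>N. \<bar>conv (g n) \<phi> x\<bar> \<le> (\<integral>x. \<bar>\<phi> x\<bar> \<partial>M)"
    using conv_bound[OF continuous bound test_fun_integrable[OF assms], of _ x] by simp
qed

lemma limit_conv_linear:
  assumes "test_fun \<phi>" "test_fun \<psi>"
  shows "limit_conv (\<lambda>z. a * \<phi> z + b * \<psi> z) x = a * limit_conv \<phi> x + b * limit_conv \<psi> x"
proof (rule LIMSEQ_unique[OF tendsto_limit_conv[OF test_fun_linear[OF assms]]])
  have "(\<lambda>n. a * conv (g n) \<phi> x + b * conv (g n) \<psi> x) \<longlonglongrightarrow> a * limit_conv \<phi> x + b * limit_conv \<psi> x"
    by (intro tendsto_intros tendsto_limit_conv assms)
  then show "(\<lambda>n. conv (g n) (\<lambda>z. a * \<phi> z + b * \<psi> z) x) \<longlonglongrightarrow> a * limit_conv \<phi> x + b * limit_conv \<psi> x"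
    using conv_add[OF continuous bound test_fun_integrable[OF assms(1)] test_fun_integrable[OF assms(2)]] by simp
qed

text \<open>This is \<open>Q\<close> of the overview, built from the limiting convolution;
  \<open>tendsto_limit_form\<close> identifies it with the limit of the forms.\<close>

definition limit_form :: "('a \<Rightarrow> real) \<Rightarrow> real" where
  "limit_form \<phi> = (\<integral>x. limit_conv \<phi> x * \<phi> x \<partial>M)"

lemma tendsto_limit_form:
  assumes \<phi>: "test_fun \<phi>"
  shows "(\<lambda>n. conv_form (g n) \<phi> \<phi>) \<longlonglongrightarrow> limit_form \<phi>"
proof (rule LIMSEQ_I)
  fix e :: real assume e: "0 < e"
  note i = test_fun_integrable[OF \<phi>]
  define N where "N = (\<integral>x. \<bar>\<phi> x\<bar> \<partial>M)"
  have N: "0 \<le> N" unfolding N_def by (rule integral_abs_nonneg)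
  have "0 < e / (N + 1)" using e N by simp
  then obtain n0 where n0: "\<And>n x. n \<ge> n0 \<Longrightarrow> \<bar>conv (g n) \<phi> x - limit_conv \<phi> x\<bar> < e / (N + 1)"
    using limit_conv_approx[OF \<phi>] by blast
  show "\<exists>no. \<forall>n\<ge>no. norm (conv_form (g n) \<phi> \<phi> - limit_form \<phi>) < e"
  proof (intro exI[of _ n0] allI impI)
    fix n assume n: "n0 \<le> n"
    have i1: "integrable M (\<lambda>x. conv (g n) \<phi> x * \<phi> x)" by (rule conv_form_integrable[OF ucont bound i i])
    have i2: "integrable M (\<lambda>x. limit_conv \<phi> x * \<phi> x)"
      by (intro integrable_mult_bounded[OF measurable_continuous limit_conv_bound[OF \<phi>]] ucont_continuous limit_conv_ucont \<phi> i)
    have "conv_form (g n) \<phi> \<phi> - limit_form \<phi> = (\<integral>x. (conv (g n) \<phi> x - limit_conv \<phi> x) * \<phi> x \<partial>M)"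
      using i1 i2 by (simp add: conv_form_def limit_form_def left_diff_distrib)
    also have "\<bar>\<dots>\<bar> \<le> e / (N + 1) * N" unfolding N_def
      by (rule integral_mult_le[OF _ i]) (use i1 i2 n0[OF n] in \<open>auto simp: left_diff_distrib N_def intro: less_imp_le\<close>)
    also have "\<dots> < e" using N e by (simp add: field_simps)
    finally show "norm (conv_form (g n) \<phi> \<phi> - limit_form \<phi>) < e" by simp
  qed
qed

lemma limit_conv_square_le:
  assumes "test_fun \<phi>"
  shows "(limit_conv \<phi> x)\<^sup>2 \<le> limit_form \<phi>"
  by (rule LIMSEQ_le[OF tendsto_power[OF tendsto_limit_conv[OF assms]] tendsto_limit_form[OF assms]])
     (use conv_square_le[OF pd at_0 ucont assms] in blast)

text \<open>An exact identity for each \<open>g n\<close> by bilinearity, preserved in the limit.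
  The factors 1 and -1 are written out so that the terms fit \<open>test_fun_linear\<close> and
  \<open>limit_conv_linear\<close>.\<close>

lemma limit_form_parallelogram:
  assumes "test_fun \<phi>" "test_fun \<psi>"
  shows "limit_form (\<lambda>z. 1 * \<phi> z + (- 1) * \<psi> z) =
    2 * limit_form \<phi> + 2 * limit_form \<psi> - 4 * limit_form (\<lambda>z. (1/2) * \<phi> z + (1/2) * \<psi> z)"
proof (rule LIMSEQ_unique[OF tendsto_limit_form[OF test_fun_linear[OF assms]]])
  have "conv_form (g n) (\<lambda>z. 1 * \<phi> z + (- 1) * \<psi> z) (\<lambda>z. 1 * \<phi> z + (- 1) * \<psi> z) =
    2 * conv_form (g n) \<phi> \<phi> + 2 * conv_form (g n) \<psi> \<psi>
      - 4 * conv_form (g n) (\<lambda>z. (1/2) * \<phi> z + (1/2) * \<psi> z) (\<lambda>z. (1/2) * \<phi> z + (1/2) * \<psi> z)" for n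
    unfolding conv_form_bilinear[OF ucont bound test_fun_integrable[OF assms(1)] test_fun_integrable[OF assms(2)]]
    by (simp add: power2_eq_square)
  then show "(\<lambda>n. conv_form (g n) (\<lambda>z. 1 * \<phi> z + (- 1) * \<psi> z) (\<lambda>z. 1 * \<phi> z + (- 1) * \<psi> z)) \<longlonglongrightarrow>
    2 * limit_form \<phi> + 2 * limit_form \<psi> - 4 * limit_form (\<lambda>z. (1/2) * \<phi> z + (1/2) * \<psi> z)"
    by (simp only:) (intro tendsto_intros tendsto_limit_form test_fun_linear assms)
qed

text \<open>Densities that nearly minimise the limiting form are Cauchy for it, and the form
  dominates the squared supremum of the limiting convolution. Independently, the support of
  \<open>\<phi> k\<close> is small on the scale on which \<open>g k\<close> varies, so smoothing
  hardly changes \<open>g k\<close>.\<close>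

lemma exists_uniform_limit:
  "\<exists>\<phi> h. (\<forall>k. test_fun (\<phi> k) \<and> (\<integral>x. \<bar>\<phi> k x\<bar> \<partial>M) = 1 \<and>
      (\<forall>x. \<bar>conv (g k) (\<phi> k) x - g k x\<bar> \<le> 1 / real (Suc k))) \<and>
    (\<forall>e>0. \<exists>N. \<forall>k\<ge>N. \<forall>x. \<bar>limit_conv (\<phi> k) x - h x\<bar> < e)"
proof -
  have "\<exists>W. open W \<and> (0::'a) \<in> W \<and> (\<forall>x y. x - y \<in> W \<longrightarrow> \<bar>g n x - g n y\<bar> \<le> 1 / real (Suc n))" for n
    using ucont[of n, unfolded ucont_def, rule_format, of "1 / real (Suc n)"] by simp
  then obtain W where W: "\<And>n. open (W n)" "\<And>n. (0::'a) \<in> W n"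
      "\<And>n x y. x - y \<in> W n \<Longrightarrow> \<bar>g n x - g n y\<bar> \<le> 1 / real (Suc n)" by metis
  \<comment> \<open>Intersecting with the earlier neighbourhoods makes the sets of densities
    decrease, as the minimising argument requires.\<close>
  define V where "V n = (\<Inter>j\<in>{..n}. W j)" for n :: nat
  have V: "open (V n)" "0 \<in> V n" "V n \<subseteq> W n" for n using W(1,2) by (auto simp: V_def)
  have Vdec: "V n \<subseteq> V m" if "m \<le> n" for m n using that by (auto simp: V_def)
  have D: "test_fun \<phi>" "(\<integral>x. \<bar>\<phi> x\<bar> \<partial>M) = 1" if "\<phi> \<in> densities (V n)" for \<phi> n
    using that densities_integral_abs by (auto simp: densities_def)
  have "\<exists>\<phi>. (\<forall>n. \<phi> n \<in> densities (V n)) \<and>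
    (\<forall>e>0. \<exists>N. \<forall>m\<ge>N. \<forall>n\<ge>N. limit_form (\<lambda>z. 1 * \<phi> m z + (- 1) * \<phi> n z) < e)"
  proof (rule minimizing_sequence_Cauchy[of "\<lambda>n. densities (V n)" limit_form 1 "\<lambda>\<phi> \<psi>. limit_form (\<lambda>z. 1 * \<phi> z + (- 1) * \<psi> z)"])
    show "0 \<le> limit_form \<phi>" if "\<phi> \<in> densities (V n)" for n \<phi>
      using limit_conv_square_le[OF D(1)[OF that], of 0] by (rule order_trans[OF zero_le_power2])
    show "\<exists>\<phi>\<in>densities (V n). limit_form \<phi> \<le> 1" for n
    proof -
      obtain \<phi> where \<phi>: "\<phi> \<in> densities (V n)" using densities_nonempty[OF V(1,2)] by blast
      have "\<bar>conv_form (g k) \<phi> \<phi>\<bar> \<le> 1" for k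
        using conv_form_bound[OF ucont bound test_fun_integrable test_fun_integrable, OF D(1)[OF \<phi>] D(1)[OF \<phi>], of k 1]
          conv_bound[OF continuous bound test_fun_integrable[OF D(1)[OF \<phi>]], of k] D(2)[OF \<phi>] by simp
      then have "limit_form \<phi> \<le> 1"
        by (intro LIMSEQ_le_const2[OF tendsto_limit_form[OF D(1)[OF \<phi>]]]) (auto simp: abs_le_iff)
      with \<phi> show ?thesis by blast
    qed
    show "densities (V n) \<subseteq> densities (V m)" if "m \<le> n" for m n using densities_mono[OF Vdec[OF that]] .
    show "\<exists>\<theta>\<in>densities (V n). limit_form (\<lambda>z. 1 * \<phi> z + (- 1) * \<psi> z) \<le> 2 * limit_form \<phi> + 2 * limit_form \<psi> - 4 * limit_form \<theta>"
      if \<phi>: "\<phi> \<in> densities (V n)" and \<psi>: "\<psi> \<in> densities (V n)" for n \<phi> \<psi>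
    proof (rule bexI)
      show "limit_form (\<lambda>z. 1 * \<phi> z + (- 1) * \<psi> z) \<le> 2 * limit_form \<phi> + 2 * limit_form \<psi> - 4 * limit_form (\<lambda>z. (1/2) * \<phi> z + (1/2) * \<psi> z)"
        using limit_form_parallelogram[OF D(1)[OF \<phi>] D(1)[OF \<psi>]] by simp
      show "(\<lambda>z. (1/2) * \<phi> z + (1/2) * \<psi> z) \<in> densities (V n)"
        using \<phi> \<psi> test_fun_linear[of \<phi> \<psi> "1/2" "1/2"] test_fun_integrable[of \<phi>] test_fun_integrable[of \<psi>]
        by (auto simp: densities_def)
    qed
  qed
  then obtain \<phi> where \<phi>: "\<And>n. \<phi> n \<in> densities (V n)"
    and c: "\<And>e. 0 < e \<Longrightarrow> \<exists>N. \<forall>m\<ge>N. \<forall>n\<ge>N. limit_form (\<lambda>z. 1 * \<phi> m z + (- 1) * \<phi> n z) < e" by blast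
  have t: "test_fun (\<phi> n)" "(\<integral>x. \<bar>\<phi> n x\<bar> \<partial>M) = 1" for n using D[OF \<phi>] by auto
  have "uniformly_Cauchy_on UNIV (\<lambda>k. limit_conv (\<phi> k))"
    unfolding uniformly_Cauchy_on_def
  proof (intro allI impI)
    fix e :: real assume e: "0 < e"
    then obtain N where N: "\<And>m n. m \<ge> N \<Longrightarrow> n \<ge> N \<Longrightarrow> limit_form (\<lambda>z. 1 * \<phi> m z + (- 1) * \<phi> n z) < e\<^sup>2"
      using c[of "e\<^sup>2"] by auto
    show "\<exists>N. \<forall>x\<in>UNIV. \<forall>m\<ge>N. \<forall>n\<ge>N. dist (limit_conv (\<phi> m) x) (limit_conv (\<phi> n) x) < e"
    proof (intro exI[of _ N] ballI allI impI)
      fix x m n assume mn: "N \<le> m" "N \<le> n"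
      \<comment> \<open>By linearity the inequality \<open>limit_conv_square_le\<close> applies to
        the difference of two densities, uniformly in x.\<close>
      have "(limit_conv (\<phi> m) x - limit_conv (\<phi> n) x)\<^sup>2 = (limit_conv (\<lambda>z. 1 * \<phi> m z + (- 1) * \<phi> n z) x)\<^sup>2"
        by (subst limit_conv_linear[OF t(1) t(1)]) simp
      also have "\<dots> \<le> limit_form (\<lambda>z. 1 * \<phi> m z + (- 1) * \<phi> n z)"
        by (intro limit_conv_square_le test_fun_linear t)
      also have "\<dots> < e\<^sup>2" by (rule N[OF mn])
      finally have "\<bar>limit_conv (\<phi> m) x - limit_conv (\<phi> n) x\<bar>\<^sup>2 < e\<^sup>2" by simp
      then show "dist (limit_conv (\<phi> m) x) (limit_conv (\<phi> n) x) < e"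
        using power2_less_imp_less[of _ e] e by (simp add: dist_real_def)
    qed
  qed
  from Cauchy_uniformly_convergent[OF this]
  have ul: "uniform_limit UNIV (\<lambda>k. limit_conv (\<phi> k)) (\<lambda>x. lim (\<lambda>k. limit_conv (\<phi> k) x)) sequentially"
    by (simp add: uniformly_convergent_uniform_limit_iff)
  have "\<bar>conv (g k) (\<phi> k) x - g k x\<bar> \<le> 1 / real (Suc k)" for k x
  proof -
    note i = test_fun_integrable[OF t(1)[of k]]
    have i1: "integrable M (\<lambda>z. g k (z - x) * \<phi> k z)" by (rule conv_integrable[OF continuous bound i])
    have "(\<integral>z. \<phi> k z \<partial>M) = 1" using \<phi>[of k] by (simp add: densities_def)
    then have "conv (g k) (\<phi> k) x - g k x = (\<integral>z. (g k (z - x) - g k x) * \<phi> k z \<partial>M)"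
      using i1 i by (simp add: conv_def left_diff_distrib)
    also have "\<bar>\<dots>\<bar> \<le> 1 / real (Suc k) * (\<integral>x. \<bar>\<phi> k x\<bar> \<partial>M)"
    proof (rule integral_mult_le[OF _ i])
      show "integrable M (\<lambda>z. (g k (z - x) - g k x) * \<phi> k z)" using i1 i by (simp add: left_diff_distrib)
      fix z assume "\<phi> k z \<noteq> 0"
      then have "z \<in> W k" using \<phi>[of k] V(3)[of k] by (auto simp: densities_def)
      \<comment> \<open>The modulus compares \<open>z - x\<close> with \<open>- x\<close>; evenness
        replaces \<open>g k (- x)\<close> by \<open>g k x\<close>.\<close>
      then show "\<bar>g k (z - x) - g k x\<bar> \<le> 1 / real (Suc k)" using W(3)[of "z - x" "- x" k] even[of k x] by simp
    qed
    finally show ?thesis using t(2) by simp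
  qed
  moreover have "\<forall>e>0. \<exists>N. \<forall>k\<ge>N. \<forall>x. \<bar>limit_conv (\<phi> k) x - lim (\<lambda>k. limit_conv (\<phi> k) x)\<bar> < e"
    using uniform_limitD[OF ul] by (simp add: eventually_sequentially dist_real_def)
  ultimately show ?thesis
    using t by (intro exI[of _ \<phi>] exI[of _ "\<lambda>x. lim (\<lambda>k. limit_conv (\<phi> k) x)"]) simp
qed

text \<open>The way from \<open>g k\<close> to \<open>h\<close> leads through
  \<open>conv (g k) (\<phi> k)\<close>, \<open>conv (g m) (\<phi> k)\<close> and
  \<open>limit_conv (\<phi> k)\<close>. Three of the four steps are small uniformly; only the change
  from k to m under the convolution has to be measured in L^1 on \<open>A\<close>.\<close>

lemma exists_L1_limit:
  "\<exists>h. ucont h \<and> (\<forall>x. \<bar>h x\<bar> \<le> 1) \<and>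
    (\<forall>A. A \<in> sets M \<longrightarrow> emeasure M A < \<infinity> \<longrightarrow> (\<lambda>k. \<integral>x. indicator A x * \<bar>g k x - h x\<bar> \<partial>M) \<longlonglongrightarrow> 0)"
proof -
  obtain \<phi> h where t: "\<And>k. test_fun (\<phi> k)" "\<And>k. (\<integral>x. \<bar>\<phi> k x\<bar> \<partial>M) = 1"
    and close: "\<And>k x. \<bar>conv (g k) (\<phi> k) x - g k x\<bar> \<le> 1 / real (Suc k)"
    and lim: "\<And>e. 0 < e \<Longrightarrow> \<exists>N. \<forall>k\<ge>N. \<forall>x. \<bar>limit_conv (\<phi> k) x - h x\<bar> < e"
    using exists_uniform_limit by metis
  have h: "ucont h"
  proof (rule ucont_uniform_approx)
    fix e :: real assume "0 < e"
    then obtain N where "\<forall>k\<ge>N. \<forall>x. \<bar>limit_conv (\<phi> k) x - h x\<bar> < e" using lim by blast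
    then show "\<exists>f. ucont f \<and> (\<forall>x. \<bar>f x - h x\<bar> \<le> e)"
      using limit_conv_ucont[OF t(1)[of N]] by (intro exI[of _ "limit_conv (\<phi> N)"]) (auto intro: less_imp_le)
  qed
  have hb: "\<bar>h x\<bar> \<le> 1" for x
  proof (rule field_le_epsilon)
    fix e :: real assume "0 < e"
    then obtain N where "\<forall>k\<ge>N. \<forall>x. \<bar>limit_conv (\<phi> k) x - h x\<bar> < e" using lim by blast
    then have "\<bar>limit_conv (\<phi> N) x - h x\<bar> < e" by simp
    with limit_conv_bound[OF t(1), of N x] t(2)[of N] show "\<bar>h x\<bar> \<le> 1 + e" by linarith
  qed
  have "(\<lambda>k. \<integral>x. indicator A x * \<bar>g k x - h x\<bar> \<partial>M) \<longlonglongrightarrow> 0" if A: "A \<in> sets M" "emeasure M A < \<infinity>" for A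
  proof (rule LIMSEQ_I)
    fix e :: real assume e: "0 < e"
    define a where "a = measure M A"
    have a: "0 \<le> a" by (simp add: a_def)
    \<comment> \<open>Three uniform errors d over measure a and one L^1 error
      \<open>d * (a + 1)\<close> add up to less than \<open>4 * (d * (a + 1)) = e\<close>.\<close>
    define d where "d = e / (4 * (a + 1))"
    have d: "0 < d" "4 * (d * (a + 1)) = e" using e a by (auto simp: d_def field_simps)
    obtain K1 where K1: "\<And>k x. k \<ge> K1 \<Longrightarrow> \<bar>limit_conv (\<phi> k) x - h x\<bar> < d" using lim[OF d(1)] by blast
    obtain K2 where K2: "1 / real (Suc K2) < d" using nat_approx_posE[OF d(1)] by blast
    obtain K3 where K3: "\<And>m n. m \<ge> K3 \<Longrightarrow> n \<ge> K3 \<Longrightarrow> (\<integral>x. (g m x - g n x)\<^sup>2 \<partial>M) < d\<^sup>2"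
      using Cauchy[of "d\<^sup>2"] d by auto
    show "\<exists>no. \<forall>k\<ge>no. norm ((\<integral>x. indicator A x * \<bar>g k x - h x\<bar> \<partial>M) - 0) < e"
    proof (intro exI[of _ "max K1 (max K2 K3)"] allI impI)
      fix k assume k: "max K1 (max K2 K3) \<le> k"
      obtain N where N: "\<And>n x. n \<ge> N \<Longrightarrow> \<bar>conv (g n) (\<phi> k) x - limit_conv (\<phi> k) x\<bar> < d"
        using limit_conv_approx[OF t(1)[of k] d(1)] by blast
      \<comment> \<open>The index m depends on k through \<open>N\<close>, but the L^2 distance of
        \<open>g m\<close> and \<open>g k\<close> is small for all indices beyond
        \<open>K3\<close>.\<close>
      define m where "m = max N K3"
      define u where "u x = g m x - g k x" for x
      have u: "ucont u" "\<And>x. \<bar>u x\<bar> \<le> 2" "\<And>x. u (- x) = u x" "integrable M (\<lambda>x. (u x)\<^sup>2)"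
        using diff_ucont[of m k] diff_bound[of m _ k] diff_square_integrable[of m k]
        by (simp_all add: u_def[abs_def] even)
      have kd: "1 / real (Suc k) \<le> d"
        using K2 frac_le[of 1 1 "real (Suc K2)" "real (Suc k)"] k by simp
      have pw: "\<bar>g k x - h x\<bar> \<le> 3 * d + \<bar>conv u (\<phi> k) x\<bar>" for x
        using close[of k x] kd N[of m x] K1[of k x] k conv_diff[OF test_fun_integrable[OF t(1)[of k]], of m k x, folded u_def[abs_def]]
        by (simp add: m_def)
      have iA: "integrable M (indicator A :: 'a \<Rightarrow> real)" using A by (simp add: integrable_indicator_iff)
      have ic: "integrable M (\<lambda>x. indicator A x * \<bar>conv u (\<phi> k) x\<bar>)"
        using conv_bound[OF ucont_continuous[OF u(1)] u(2) test_fun_integrable[OF t(1)[of k]]]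
        by (intro indicator_mult_integrable[where B = 2] A continuous_on_rabs ucont_continuous
            conv_ucont[OF u(1,2) test_fun_integrable[OF t(1)]]) (simp add: t(2))
      have "(\<integral>x. indicator A x * \<bar>g k x - h x\<bar> \<partial>M) \<le> (\<integral>x. 3 * d * indicator A x + indicator A x * \<bar>conv u (\<phi> k) x\<bar> \<partial>M)"
      proof (rule integral_mono)
        show "integrable M (\<lambda>x. indicator A x * \<bar>g k x - h x\<bar>)"
        proof (rule indicator_mult_integrable[OF _ _ A])
          show "continuous_on UNIV (\<lambda>x. \<bar>g k x - h x\<bar>)"
            by (intro continuous_on_rabs ucont_continuous ucont_diff ucont h)
          show "\<bar>\<bar>g k x - h x\<bar>\<bar> \<le> 2" for x using bound[of k x] hb[of x] by linarith
        qed
        show "integrable M (\<lambda>x. 3 * d * indicator A x + indicator A x * \<bar>conv u (\<phi> k) x\<bar>)"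
          by (intro Bochner_Integration.integrable_add integrable_mult_right iA ic)
        show "indicator A x * \<bar>g k x - h x\<bar> \<le> 3 * d * indicator A x + indicator A x * \<bar>conv u (\<phi> k) x\<bar>" for x
          using pw[of x] by (simp add: indicator_def)
      qed
      also have "\<dots> = 3 * d * a + (\<integral>x. indicator A x * \<bar>conv u (\<phi> k) x\<bar> \<partial>M)"
        using iA ic A by (simp add: a_def sets.Int_space_eq2)
      also have "(\<integral>x. indicator A x * \<bar>conv u (\<phi> k) x\<bar> \<partial>M) \<le> sqrt (a * (\<integral>x. (u x)\<^sup>2 \<partial>M))"
        using conv_L1_bound[OF u t(1)[of k] A] by (simp add: t(2) a_def)
      also have "\<dots> \<le> d * (a + 1)"
      proof (rule real_le_lsqrt)
        have "a * (\<integral>x. (u x)\<^sup>2 \<partial>M) \<le> (a + 1) * d\<^sup>2"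
          using K3[of m k] k a by (intro mult_mono) (auto simp: u_def m_def intro: less_imp_le)
        also have "\<dots> \<le> (a + 1)\<^sup>2 * d\<^sup>2" using a by (intro mult_right_mono) (auto simp: power2_eq_square)
        finally show "a * (\<integral>x. (u x)\<^sup>2 \<partial>M) \<le> (d * (a + 1))\<^sup>2" by (simp add: power_mult_distrib mult.commute)
      qed (use a d in auto)
      finally have "(\<integral>x. indicator A x * \<bar>g k x - h x\<bar> \<partial>M) \<le> 3 * d * a + d * (a + 1)" by simp
      also have "\<dots> < e" using d by (simp add: algebra_simps)
      finally have "(\<integral>x. indicator A x * \<bar>g k x - h x\<bar> \<partial>M) < e" .
      moreover have "0 \<le> (\<integral>x. indicator A x * \<bar>g k x - h x\<bar> \<partial>M)"
        by (rule Bochner_Integration.integral_nonneg) simp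
      ultimately show "norm ((\<integral>x. indicator A x * \<bar>g k x - h x\<bar> \<partial>M) - 0) < e" by simp
    qed
  qed
  with h hb show ?thesis by blast
qed

section \<open>Properties inherited by the L^1 limit\<close>

context
  fixes h :: "'a \<Rightarrow> real"
  assumes h: "ucont h" and h_bound: "\<And>x. \<bar>h x\<bar> \<le> 1"
    and L1: "\<And>A. A \<in> sets M \<Longrightarrow> emeasure M A < \<infinity> \<Longrightarrow> (\<lambda>k. \<integral>x. indicator A x * \<bar>g k x - h x\<bar> \<partial>M) \<longlonglongrightarrow> 0"
begin

text \<open>For z in \<open>b + V\<close> and y in \<open>a + V\<close> the difference
  \<open>z - y\<close> stays in the fixed translate \<open>A\<close> of \<open>W\<close>. The error
  is therefore at most the L^1 distance of \<open>g k\<close> and \<open>h\<close> on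
  \<open>A\<close>, times the measure of \<open>V\<close>.\<close>

lemma tendsto_conv_form_indicator:
  assumes V: "open V" "V \<subseteq> K" "compact K" and W: "open W" "W \<subseteq> K"
    and VW: "\<And>v w. v \<in> V \<Longrightarrow> w \<in> V \<Longrightarrow> v - w \<in> W"
  shows "(\<lambda>k. conv_form (g k) (indicator {x. x - b \<in> V}) (indicator {x. x - a \<in> V})) \<longlonglongrightarrow>
    conv_form h (indicator {x. x - b \<in> V}) (indicator {x. x - a \<in> V})"
proof -
  define \<phi> :: "'a \<Rightarrow> real" where "\<phi> = indicator {x. x - b \<in> V}"
  define \<psi> :: "'a \<Rightarrow> real" where "\<psi> = indicator {x. x - a \<in> V}"
  define v where "v = measure M V"
  have i: "integrable M \<phi>" "integrable M \<psi>"
    using test_fun_indicator(1)[OF V] by (auto simp: \<phi>_def \<psi>_def intro: test_fun_integrable)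
  have n: "(\<integral>x. \<bar>\<psi> x\<bar> \<partial>M) = v"
    using test_fun_indicator(2)[OF V] by (simp add: \<psi>_def v_def)
  define A where "A = {x. x - (b - a) \<in> W}"
  have A: "A \<in> sets M" "emeasure M A < \<infinity>"
    using emeasure_vimage_translate[of W "b - a"] test_fun_indicator(3)[OF W V(3)] W by (auto simp: A_def sets_M)
  define \<epsilon> where "\<epsilon> k = (\<integral>x. indicator A x * \<bar>g k x - h x\<bar> \<partial>M)" for k
  note ch = ucont_continuous[OF h]
  have key: "\<bar>conv_form (g k) \<phi> \<psi> - conv_form h \<phi> \<psi>\<bar> \<le> \<epsilon> k * v" for k
  proof -
    have u: "continuous_on UNIV (\<lambda>x. \<bar>g k x - h x\<bar>)" by (intro continuous_on_rabs ucont_continuous ucont_diff ucont h)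
    have ub: "\<bar>\<bar>g k x - h x\<bar>\<bar> \<le> 2" for x using bound[of k x] h_bound[of x] by linarith
    have iu: "integrable M (\<lambda>x. indicator A x * \<bar>g k x - h x\<bar>)" by (rule indicator_mult_integrable[OF u ub A])
    have inner: "\<bar>conv (g k) \<phi> y - conv h \<phi> y\<bar> \<le> \<epsilon> k" if y: "\<psi> y \<noteq> 0" for y
    proof -
      have i1: "integrable M (\<lambda>z. g k (z - y) * \<phi> z)" "integrable M (\<lambda>z. h (z - y) * \<phi> z)"
        using conv_integrable[OF continuous bound i(1)] conv_integrable[OF ch h_bound i(1)] by auto
      have "conv (g k) \<phi> y - conv h \<phi> y = (\<integral>z. g k (z - y) * \<phi> z - h (z - y) * \<phi> z \<partial>M)"
        unfolding conv_def using i1 by simp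
      also have "\<bar>\<dots>\<bar> \<le> (\<integral>z. indicator A (z - y) * \<bar>g k (z - y) - h (z - y)\<bar> \<partial>M)"
      proof (rule integral_abs_le)
        show "integrable M (\<lambda>z. g k (z - y) * \<phi> z - h (z - y) * \<phi> z)" using i1 by simp
        show "integrable M (\<lambda>z. indicator A (z - y) * \<bar>g k (z - y) - h (z - y)\<bar>)"
          using iu integral_translate(2)[OF borel_measurable_integrable[OF iu], of y] by simp
        fix z
        have "z - y \<in> A" if "z - b \<in> V"
          using VW[OF that, of "y - a"] y by (auto simp: A_def \<psi>_def indicator_def algebra_simps split: if_splits)
        then show "\<bar>g k (z - y) * \<phi> z - h (z - y) * \<phi> z\<bar> \<le> indicator A (z - y) * \<bar>g k (z - y) - h (z - y)\<bar>"
          by (auto simp: \<phi>_def indicator_def)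
      qed
      also have "\<dots> = \<epsilon> k" unfolding \<epsilon>_def by (rule integral_translate(1)[OF borel_measurable_integrable[OF iu]])
      finally show ?thesis .
    qed
    have ic: "integrable M (\<lambda>y. conv (g k) \<phi> y * \<psi> y)" "integrable M (\<lambda>y. conv h \<phi> y * \<psi> y)"
      using conv_form_integrable[OF ucont bound i] conv_form_integrable[OF h h_bound i] by auto
    have "conv_form (g k) \<phi> \<psi> - conv_form h \<phi> \<psi> = (\<integral>y. (conv (g k) \<phi> y - conv h \<phi> y) * \<psi> y \<partial>M)"
      using ic by (simp add: conv_form_def left_diff_distrib)
    also have "\<bar>\<dots>\<bar> \<le> \<epsilon> k * (\<integral>x. \<bar>\<psi> x\<bar> \<partial>M)"
      by (rule integral_mult_le[OF _ i(2) inner]) (use ic in \<open>simp_all add: left_diff_distrib\<close>)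
    finally show ?thesis by (simp only: n)
  qed
  have "(\<lambda>k. \<epsilon> k * v) \<longlonglongrightarrow> 0" using tendsto_mult_right[OF L1[OF A], of v] by (simp add: \<epsilon>_def)
  then have "(\<lambda>k. conv_form (g k) \<phi> \<psi> - conv_form h \<phi> \<psi>) \<longlonglongrightarrow> 0"
    by (rule Lim_null_comparison[rotated]) (use key in auto)
  then show ?thesis by (simp add: LIM_zero_iff \<phi>_def \<psi>_def)
qed

text \<open>The symmetry is known for the forms of \<open>g k\<close> and passes to the form of
  \<open>h\<close> on indicators. Double averages then compare \<open>h x\<close> with
  \<open>h (- x)\<close>.\<close>

lemma L1_limit_even: "h (- x) = h x"
proof -
  have "\<bar>h x - h (- x)\<bar> \<le> 0"
  proof (rule field_le_epsilon)
    fix e :: real assume "0 < e"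
    then have e2: "0 < e / 2" by simp
    obtain V W K where V: "open V" "0 \<in> V" "V \<subseteq> K" "open W" "W \<subseteq> K" "compact K"
      "\<And>v w. v \<in> V \<Longrightarrow> w \<in> V \<Longrightarrow> v - w \<in> W"
      "\<forall>x y. \<forall>v\<in>V. \<forall>w\<in>V. x - y = v - w \<longrightarrow> \<bar>h x - h y\<bar> \<le> e / 2"
      by (rule small_nbhd[OF h e2]) (rule that)
    define v where "v = (measure M V)\<^sup>2"
    have "0 < measure M V" using V(2) by (intro measure_open_pos[OF V(1) _ test_fun_indicator(3)[OF V(1,3,6)]]) auto
    then have v: "0 < v" by (simp add: v_def)
    have "conv_form (g k) (indicator {z. z - x \<in> V}) (indicator {z. z - 0 \<in> V}) =
        conv_form (g k) (indicator {z. z - 0 \<in> V}) (indicator {z. z - x \<in> V})" for k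
      by (intro conv_form_sym[OF ucont bound even] test_fun_integrable test_fun_indicator(1)[OF V(1,3,6)])
    then have "conv_form h (indicator {z. z - x \<in> V}) (indicator {z. z - 0 \<in> V}) =
        conv_form h (indicator {z. z - 0 \<in> V}) (indicator {z. z - x \<in> V})"
      using tendsto_conv_form_indicator[OF V(1,3,6,4,5,7), where b = x and a = 0] tendsto_conv_form_indicator[OF V(1,3,6,4,5,7), where b = 0 and a = x]
      by (auto intro: LIMSEQ_unique)
    note sym = this
    define X where "X = conv_form h (indicator {z. z - x \<in> V}) (indicator {z. z - 0 \<in> V})"
    have X: "\<bar>X - h x * v\<bar> \<le> e / 2 * v" "\<bar>X - h (- x) * v\<bar> \<le> e / 2 * v"
      using conv_form_indicator_approx[OF h h_bound V(1,3,6,8), where b = x and a = 0]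
        conv_form_indicator_approx[OF h h_bound V(1,3,6,8), where b = 0 and a = x]
      unfolding v_def X_def sym by (simp_all only: sym diff_0 diff_0_right)
    have "\<bar>h x * v - h (- x) * v\<bar> \<le> \<bar>X - h (- x) * v\<bar> + \<bar>X - h x * v\<bar>"
      using abs_triangle_ineq4[of "X - h (- x) * v" "X - h x * v"] by simp
    also have "\<dots> \<le> e / 2 * v + e / 2 * v" by (intro add_mono X)
    also have "\<dots> = e * v" by simp
    finally have "\<bar>h x * v - h (- x) * v\<bar> \<le> e * v" .
    then have "\<bar>h x - h (- x)\<bar> * v \<le> e * v" using v by (simp add: left_diff_distrib[symmetric] abs_mult)
    then show "\<bar>h x - h (- x)\<bar> \<le> 0 + e" using v by simp
  qed
  then show ?thesis by simp
qed

text \<open>Each point \<open>p i\<close> is smeared out to the indicator of \<open>p i + V\<close>.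
  The resulting forms are nonnegative for \<open>g k\<close>, hence for \<open>h\<close>, and after
  division by the squared measure of \<open>V\<close> they approximate the discrete sum.\<close>

lemma L1_limit_positive_definite: "positive_definite h"
proof (rule positive_definiteI, rule L1_limit_even)
  fix n :: nat and c :: "nat \<Rightarrow> real" and p :: "nat \<Rightarrow> 'a"
  define S where "S = (\<Sum>i\<in>{1..n}. \<Sum>j\<in>{1..n}. c i * c j * h (p i - p j))"
  define T where "T = (\<Sum>i\<in>{1..n}. \<Sum>j\<in>{1..n}. \<bar>c i * c j\<bar>)"
  have T: "0 \<le> T" unfolding T_def by (intro sum_nonneg) auto
  have "0 \<le> S"
  proof (rule field_le_epsilon)
    fix e' :: real assume e': "0 < e'"
    define e where "e = e' / (T + 1)"
    have e: "0 < e" "e * T \<le> e'" using e' T by (auto simp: e_def field_simps)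
    obtain V W K where V: "open V" "0 \<in> V" "V \<subseteq> K" "open W" "W \<subseteq> K" "compact K"
      "\<And>v w. v \<in> V \<Longrightarrow> w \<in> V \<Longrightarrow> v - w \<in> W"
      "\<forall>x y. \<forall>v\<in>V. \<forall>w\<in>V. x - y = v - w \<longrightarrow> \<bar>h x - h y\<bar> \<le> e"
      by (rule small_nbhd[OF h e(1)]) (rule that)
    define v where "v = (measure M V)\<^sup>2"
    have "0 < measure M V" using V(2) by (intro measure_open_pos[OF V(1) _ test_fun_indicator(3)[OF V(1,3,6)]]) auto
    then have v: "0 < v" by (simp add: v_def)
    define \<phi> :: "nat \<Rightarrow> 'a \<Rightarrow> real" where "\<phi> i = indicator {z. z - p i \<in> V}" for i
    have t: "test_fun (\<phi> i)" for i unfolding \<phi>_def by (rule test_fun_indicator(1)[OF V(1,3,6)])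
    define Q where "Q f = (\<Sum>i\<in>{1..n}. \<Sum>j\<in>{1..n}. c i * c j * conv_form f (\<phi> i) (\<phi> j))" for f
    have "0 \<le> Q (g k)" for k
    proof -
      have "Q (g k) = conv_form (g k) (\<lambda>x. \<Sum>i\<in>{1..n}. c i * \<phi> i x) (\<lambda>x. \<Sum>i\<in>{1..n}. c i * \<phi> i x)"
        unfolding Q_def by (rule conv_form_sum[OF ucont bound, symmetric]) (rule test_fun_integrable[OF t])
      \<comment> \<open>The form of a test function with itself dominates a square, here that of the
        convolution at 0.\<close>
      also have "\<dots> \<ge> 0"
        by (rule order_trans[OF zero_le_power2 conv_square_le[OF pd at_0 ucont test_fun_sum[OF _ t], where x = 0]]) simp
      finally show ?thesis .
    qed
    moreover have "(\<lambda>k. Q (g k)) \<longlonglongrightarrow> Q h"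
      unfolding Q_def \<phi>_def by (intro tendsto_sum tendsto_mult_left tendsto_conv_form_indicator[OF V(1,3,6,4,5,7)])
    ultimately have Q: "0 \<le> Q h" by (intro LIMSEQ_le_const) auto
    have "Q h - S * v = (\<Sum>i\<in>{1..n}. \<Sum>j\<in>{1..n}. c i * c j * (conv_form h (\<phi> i) (\<phi> j) - h (p i - p j) * v))"
      by (simp add: Q_def S_def sum_distrib_right right_diff_distrib sum_subtractf mult.assoc)
    also have "\<bar>\<dots>\<bar> \<le> (\<Sum>i\<in>{1..n}. \<Sum>j\<in>{1..n}. \<bar>c i * c j\<bar> * (e * v))"
    proof (rule order_trans[OF sum_abs sum_mono], rule order_trans[OF sum_abs sum_mono])
      fix i j
      show "\<bar>c i * c j * (conv_form h (\<phi> i) (\<phi> j) - h (p i - p j) * v)\<bar> \<le> \<bar>c i * c j\<bar> * (e * v)"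
        unfolding abs_mult[of "c i * c j" "_ - _"] \<phi>_def v_def
        by (intro mult_left_mono conv_form_indicator_approx[OF h h_bound V(1,3,6,8)]) simp
    qed
    also have "\<dots> = T * (e * v)" by (simp add: T_def sum_distrib_right)
    finally have "0 \<le> (S + e * T) * v" using Q by (simp add: algebra_simps)
    then have "0 \<le> S + e * T" using v by (simp add: zero_le_mult_iff)
    with e(2) show "0 \<le> S + e'" by linarith
  qed
  then show "0 \<le> (\<Sum>i\<in>{1..n}. \<Sum>j\<in>{1..n}. c i * c j * h (p i - p j))" by (simp add: S_def)
qed

lemma L1_limit_nonpos:
  assumes \<Omega>: "closed \<Omega>" and nonpos: "\<And>k x. x \<notin> \<Omega> \<Longrightarrow> g k x \<le> 0" and x: "x \<notin> \<Omega>"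
  shows "h x \<le> 0"
proof (rule ccontr)
  assume "\<not> h x \<le> 0"
  then have hx: "0 < h x" by simp
  define d where "d = h x / 2"
  obtain U K where U: "open U" "(0::'a) \<in> U" "compact K" "U \<subseteq> K" by (rule compact_nbhd)
  \<comment> \<open>On this open set \<open>g k \<le> 0\<close> and \<open>h > d\<close>, so the L^1
    distance on it is at least \<open>d * measure M A\<close> for every k. The translate of
    \<open>U\<close> keeps the measure finite.\<close>
  define A where "A = h -` {d<..} \<inter> - \<Omega> \<inter> {y. y - x \<in> U}"
  have A: "open A" unfolding A_def
    using ucont_continuous[OF h] \<Omega> U by (intro open_Int open_vimage_diff_left open_vimage) auto
  then have As: "A \<in> sets M" by (simp add: sets_M)
  have Us: "U \<in> sets M" using U by (simp add: sets_M)
  have "emeasure M A \<le> emeasure M {y. y - x \<in> U}"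
    using emeasure_vimage_translate(1)[OF Us] by (intro emeasure_mono) (auto simp: A_def)
  also have "\<dots> < \<infinity>" using emeasure_vimage_translate(2)[OF Us] test_fun_indicator(3)[OF U(1,4,3)] by simp
  finally have Af: "emeasure M A < \<infinity>" .
  have "x \<in> A" using x hx U by (simp add: A_def d_def)
  then have "0 < measure M A" by (intro measure_open_pos[OF A _ Af]) auto
  then have pos: "0 < d * measure M A" using hx by (simp add: d_def)
  have "d * measure M A \<le> (\<integral>x. indicator A x * \<bar>g k x - h x\<bar> \<partial>M)" for k
  proof -
    have "d * measure M A = (\<integral>x. d * indicator A x \<partial>M)" using As by (simp add: sets.Int_space_eq2)
    also have "\<dots> \<le> (\<integral>x. indicator A x * \<bar>g k x - h x\<bar> \<partial>M)"
    proof (rule integral_mono)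
      show "integrable M (\<lambda>x. d * indicator A x)" using As Af by (intro integrable_mult_right) (simp add: integrable_indicator_iff)
      show "integrable M (\<lambda>x. indicator A x * \<bar>g k x - h x\<bar>)"
      proof (rule indicator_mult_integrable[OF _ _ As Af])
        show "continuous_on UNIV (\<lambda>x. \<bar>g k x - h x\<bar>)"
          by (intro continuous_on_rabs ucont_continuous ucont_diff ucont h)
        show "\<bar>\<bar>g k x - h x\<bar>\<bar> \<le> 2" for x using bound[of k x] h_bound[of x] by linarith
      qed
      fix y
      show "d * indicator A y \<le> indicator A y * \<bar>g k y - h y\<bar>"
        using nonpos[of y k] by (auto simp: A_def indicator_def)
    qed
    finally show ?thesis .
  qed
  then have "d * measure M A \<le> 0" by (intro LIMSEQ_le_const[OF L1[OF As Af]]) auto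
  with pos show False by simp
qed

lemma indicator_integral_diff_le:
  assumes A: "A \<in> sets M" "emeasure M A < \<infinity>"
  shows "integrable M (\<lambda>x. indicator A x * h x)" "integrable M (\<lambda>x. indicator A x * g k x)"
    and "(\<integral>x. indicator A x * g k x \<partial>M) \<le> (\<integral>x. indicator A x * h x \<partial>M) + (\<integral>x. indicator A x * \<bar>g k x - h x\<bar> \<partial>M)"
    and "(\<integral>x. indicator A x * \<bar>h x\<bar> \<partial>M) \<le> (\<integral>x. \<bar>g k x\<bar> \<partial>M) + (\<integral>x. indicator A x * \<bar>g k x - h x\<bar> \<partial>M)"
proof -
  have id: "integrable M (\<lambda>x. indicator A x * \<bar>g k x - h x\<bar>)"
  proof (rule indicator_mult_integrable[OF _ _ A])
    show "continuous_on UNIV (\<lambda>x. \<bar>g k x - h x\<bar>)"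
      by (intro continuous_on_rabs ucont_continuous ucont_diff ucont h)
    show "\<bar>\<bar>g k x - h x\<bar>\<bar> \<le> 2" for x using bound[of k x] h_bound[of x] by linarith
  qed
  show ih: "integrable M (\<lambda>x. indicator A x * h x)"
    by (rule indicator_mult_integrable[OF ucont_continuous[OF h] h_bound A])
  show ig: "integrable M (\<lambda>x. indicator A x * g k x)"
    by (rule indicator_mult_integrable[OF continuous bound A])
  have iah: "integrable M (\<lambda>x. indicator A x * \<bar>h x\<bar>)"
    using integrable_abs[OF ih] by (simp add: abs_mult)
  have "(\<integral>x. indicator A x * g k x \<partial>M) \<le> (\<integral>x. indicator A x * h x + indicator A x * \<bar>g k x - h x\<bar> \<partial>M)"
    by (rule integral_mono[OF ig Bochner_Integration.integrable_add[OF ih id]]) (auto simp: indicator_def)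
  then show "(\<integral>x. indicator A x * g k x \<partial>M) \<le> (\<integral>x. indicator A x * h x \<partial>M) + (\<integral>x. indicator A x * \<bar>g k x - h x\<bar> \<partial>M)"
    using ih id by simp
  have "(\<integral>x. indicator A x * \<bar>h x\<bar> \<partial>M) \<le> (\<integral>x. \<bar>g k x\<bar> + indicator A x * \<bar>g k x - h x\<bar> \<partial>M)"
    by (rule integral_mono[OF iah Bochner_Integration.integrable_add[OF integrable_abs[OF integrable] id]])
       (auto simp: indicator_def)
  then show "(\<integral>x. indicator A x * \<bar>h x\<bar> \<partial>M) \<le> (\<integral>x. \<bar>g k x\<bar> \<partial>M) + (\<integral>x. indicator A x * \<bar>g k x - h x\<bar> \<partial>M)"
    using id integrable by simp
qed

text \<open>A countable exhaustion of the set where \<open>h\<close> is nonzero. Its members will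
  turn out to have finite measure, which replaces \<sigma>-finiteness of \<open>M\<close> in the
  limit arguments below.\<close>

definition level :: "nat \<Rightarrow> 'a set" where
  "level j = {x. 1 / real (Suc j) < \<bar>h x\<bar>}"

lemma level_mono: "i \<le> j \<Longrightarrow> level i \<subseteq> level j"
  using frac_le[of 1 1 "real (Suc i)" "real (Suc j)"] by (auto simp: level_def)

lemma eventually_level:
  assumes "h x \<noteq> 0"
  shows "eventually (\<lambda>j. x \<in> level j) sequentially"
proof -
  obtain n where "1 / real (Suc n) < \<bar>h x\<bar>" using nat_approx_posE[of "\<bar>h x\<bar>"] assms by auto
  then have "x \<in> level n" by (simp add: level_def)
  then show ?thesis using level_mono by (auto simp: eventually_sequentially)
qed

context
  fixes C assumes C: "\<And>k. (\<integral>x. \<bar>g k x\<bar> \<partial>M) \<le> C"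
begin

lemma indicator_abs_integral_le:
  assumes A: "A \<in> sets M" "emeasure M A < \<infinity>"
  shows "(\<integral>x. indicator A x * \<bar>h x\<bar> \<partial>M) \<le> C"
proof -
  have "(\<lambda>k. C + (\<integral>x. indicator A x * \<bar>g k x - h x\<bar> \<partial>M)) \<longlonglongrightarrow> C + 0"
    by (intro tendsto_intros L1[OF A])
  then have "(\<integral>x. indicator A x * \<bar>h x\<bar> \<partial>M) \<le> C + 0"
    using indicator_integral_diff_le(4)[OF A] C by (intro LIMSEQ_le_const) (auto intro: order_trans[OF _ add_right_mono])
  then show ?thesis by simp
qed

text \<open>Integrability of \<open>h\<close> is not yet known, so Chebyshev's inequality is applied
  on compact subsets, where L^1 convergence gives the bound \<open>C\<close>. Inner regularity
  carries the estimate over to the open level set.\<close>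

lemma level_sets: "open (level j)" "level j \<in> sets M" "emeasure M (level j) < \<infinity>"
proof -
  have "level j = (\<lambda>x. \<bar>h x\<bar>) -` {1 / real (Suc j)<..}" by (auto simp: level_def)
  then show o: "open (level j)"
    using open_vimage[of "{1 / real (Suc j)<..}" "\<lambda>x. \<bar>h x\<bar>"] ucont_continuous[OF h]
    by (simp add: continuous_on_rabs)
  then show "level j \<in> sets M" by (simp add: sets_M)
  have "emeasure M K \<le> ennreal (C * real (Suc j))" if K: "compact K" "K \<subseteq> level j" for K
  proof -
    have Ks: "K \<in> sets M" "emeasure M K < \<infinity>" using K emeasure_compact by (auto simp: sets_M compact_imp_closed)
    have "1 / real (Suc j) * measure M K = (\<integral>x. 1 / real (Suc j) * indicator K x \<partial>M)"
      using Ks by (simp add: sets.Int_space_eq2)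
    also have "\<dots> \<le> (\<integral>x. indicator K x * \<bar>h x\<bar> \<partial>M)"
    proof (rule integral_mono)
      show "integrable M (\<lambda>x. 1 / real (Suc j) * indicator K x)"
        using Ks by (intro integrable_mult_right) (simp add: integrable_indicator_iff)
      show "integrable M (\<lambda>x. indicator K x * \<bar>h x\<bar>)"
        using integrable_abs[OF indicator_integral_diff_le(1)[OF Ks]] by (simp add: abs_mult)
      show "1 / real (Suc j) * indicator K x \<le> indicator K x * \<bar>h x\<bar>" for x
        using K(2) by (auto simp: level_def indicator_def intro: less_imp_le)
    qed
    also have "\<dots> \<le> C" by (rule indicator_abs_integral_le[OF Ks])
    finally have "measure M K \<le> C * real (Suc j)" by (simp add: field_simps)
    then have "ennreal (measure M K) \<le> ennreal (C * real (Suc j))" by (rule ennreal_leI)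
    then show ?thesis using Ks(2) by (simp add: emeasure_eq_ennreal_measure)
  qed
  then have "emeasure M (level j) \<le> ennreal (C * real (Suc j))"
    unfolding emeasure_open_inner[OF o] by (intro SUP_least) auto
  also have "\<dots> < \<infinity>" by simp
  finally show "emeasure M (level j) < \<infinity>" .
qed

lemma L1_limit_integrable: "integrable M h"
proof -
  let ?f = "\<lambda>j x. indicator (level j) x * \<bar>h x\<bar>"
  have i: "integrable M (?f j)" for j
    using integrable_abs[OF indicator_integral_diff_le(1)[OF level_sets(2,3)]] by (simp add: abs_mult)
  have mono: "?f i x \<le> ?f j x" if "i \<le> j" for i j x
    using level_mono[OF that] by (auto simp: indicator_def)
  have "incseq (\<lambda>j. \<integral>x. ?f j x \<partial>M)"
    unfolding incseq_def using mono i by (auto intro!: integral_mono)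
  then obtain L where L: "(\<lambda>j. \<integral>x. ?f j x \<partial>M) \<longlonglongrightarrow> L"
    using incseq_convergent[of "\<lambda>j. \<integral>x. ?f j x \<partial>M" C] indicator_abs_integral_le[OF level_sets(2,3)] by blast
  have "integrable M (\<lambda>x. \<bar>h x\<bar>)"
  proof (rule integrable_monotone_convergence[OF i _ _ L])
    show "AE x in M. mono (\<lambda>j. ?f j x)" using mono by (auto simp: mono_def)
    show "AE x in M. (\<lambda>j. ?f j x) \<longlonglongrightarrow> \<bar>h x\<bar>"
    proof (rule AE_I2)
      fix x
      show "(\<lambda>j. ?f j x) \<longlonglongrightarrow> \<bar>h x\<bar>"
      proof (cases "h x = 0")
        case False
        from eventually_level[OF this] have "eventually (\<lambda>j. ?f j x = \<bar>h x\<bar>) sequentially"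
          by eventually_elim simp
        then show ?thesis by (rule tendsto_eventually)
      qed simp
    qed
    show "(\<lambda>x. \<bar>h x\<bar>) \<in> borel_measurable M"
      by (intro measurable_continuous continuous_on_rabs ucont_continuous h)
  qed
  then show ?thesis
    using integrable_abs_iff[OF measurable_continuous[OF ucont_continuous[OF h]]] by simp
qed

text \<open>Outside \<open>\<Omega> \<union> level j\<close> only nonpositive values of
  \<open>g k\<close> are discarded, so restricting the integral does not lower it. The limit in k is
  taken on this set of finite measure with j fixed; then j tends to infinity by dominated
  convergence.\<close>

lemma L1_limit_integral_ge:
  assumes \<Omega>: "\<Omega> \<in> sets M" "emeasure M \<Omega> < \<infinity>" and nonpos: "\<And>k x. x \<notin> \<Omega> \<Longrightarrow> g k x \<le> 0"
    and D: "\<And>k. D - 1 / real (Suc k) \<le> (\<integral>x. g k x \<partial>M)"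
  shows "D \<le> (\<integral>x. h x \<partial>M)"
proof -
  define A where "A j = \<Omega> \<union> level j" for j
  have A: "A j \<in> sets M" "emeasure M (A j) < \<infinity>" for j
  proof -
    show "A j \<in> sets M" using \<Omega> level_sets(2) by (auto simp: A_def)
    have "emeasure M (A j) \<le> emeasure M \<Omega> + emeasure M (level j)"
      unfolding A_def by (intro emeasure_subadditive \<Omega> level_sets)
    also have "\<dots> < \<infinity>" using \<Omega>(2) level_sets(3)[of j] by simp
    finally show "emeasure M (A j) < \<infinity>" .
  qed
  have DA: "D \<le> (\<integral>x. indicator (A j) x * h x \<partial>M)" for j
  proof -
    have "D - 1 / real (Suc k) \<le> (\<integral>x. indicator (A j) x * h x \<partial>M) + (\<integral>x. indicator (A j) x * \<bar>g k x - h x\<bar> \<partial>M)" for k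
    proof -
      have "(\<integral>x. g k x \<partial>M) \<le> (\<integral>x. indicator (A j) x * g k x \<partial>M)"
        using nonpos by (intro integral_mono integrable indicator_integral_diff_le(2) A) (auto simp: indicator_def A_def)
      with indicator_integral_diff_le(3)[OF A, of j k] D[of k] show ?thesis by linarith
    qed
    moreover have "(\<lambda>k. D - 1 / real (Suc k)) \<longlonglongrightarrow> D - 0"
      by (intro tendsto_intros LIMSEQ_Suc lim_1_over_n)
    moreover have "(\<lambda>k. (\<integral>x. indicator (A j) x * h x \<partial>M) + (\<integral>x. indicator (A j) x * \<bar>g k x - h x\<bar> \<partial>M))
        \<longlonglongrightarrow> (\<integral>x. indicator (A j) x * h x \<partial>M) + 0"
      by (intro tendsto_intros L1 A)
    ultimately show ?thesis by (auto intro: LIMSEQ_le)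
  qed
  have "(\<lambda>j. \<integral>x. indicator (A j) x * h x \<partial>M) \<longlonglongrightarrow> (\<integral>x. h x \<partial>M)"
  proof (rule integral_dominated_convergence)
    show "h \<in> borel_measurable M" by (intro measurable_continuous ucont_continuous h)
    show "(\<lambda>x. indicator (A j) x * h x) \<in> borel_measurable M" for j
      by (rule borel_measurable_integrable[OF indicator_integral_diff_le(1)[OF A]])
    show "integrable M (\<lambda>x. \<bar>h x\<bar>)" using L1_limit_integrable by simp
    show "AE x in M. norm (indicator (A j) x * h x) \<le> \<bar>h x\<bar>" for j by (auto simp: indicator_def)
    show "AE x in M. (\<lambda>j. indicator (A j) x * h x) \<longlonglongrightarrow> h x"
    proof (rule AE_I2)
      fix x
      show "(\<lambda>j. indicator (A j) x * h x) \<longlonglongrightarrow> h x"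
      proof (cases "h x = 0")
        case False
        from eventually_level[OF this] have "eventually (\<lambda>j. indicator (A j) x * h x = h x) sequentially"
          by eventually_elim (simp add: A_def)
        then show ?thesis by (rule tendsto_eventually)
      qed simp
    qed
  qed
  then show ?thesis by (rule LIMSEQ_le_const) (use DA in blast)
qed

end

end

end

section \<open>Extremal functions\<close>

context haar_group
begin

lemma GG_nonpos: "f \<in> GG M \<Omega> \<Longrightarrow> x \<notin> \<Omega> \<Longrightarrow> f x \<le> 0"
  using closure_subset[of "{x. pos_part f x \<noteq> 0}"]
  by (force simp: GG_def supp_def pos_part_def)

text \<open>For closed \<Omega> the support condition on the positive part amounts to nonpositivity
  off \<Omega>, which is far easier to pass to limits and averages.\<close>

lemma GG_I:
  assumes "ucont f" "positive_definite f" "f 0 = 1" "integrable M f" "closed \<Omega>" "\<And>x. x \<notin> \<Omega> \<Longrightarrow> f x \<le> 0"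
  shows "f \<in> GG M \<Omega>"
proof -
  have "closure {x. pos_part f x \<noteq> 0} \<subseteq> \<Omega>"
    using assms(6) by (intro closure_minimal assms(5)) (auto simp: pos_part_def max_def split: if_splits)
  then show ?thesis using assms ucont_continuous by (simp add: GG_def P1_def supp_def)
qed

lemma GG_midpoint:
  assumes f: "f \<in> GG M \<Omega>" and g: "g \<in> GG M \<Omega>" and \<Omega>: "closed \<Omega>"
  shows "(\<lambda>x. (f x + g x) / 2) \<in> GG M \<Omega>"
proof -
  have pd: "positive_definite f" "positive_definite g" using f g by (auto simp: GG_def P1_def)
  have "positive_definite (\<lambda>x. (f x + g x) / 2)"
  proof (rule positive_definiteI)
    show "(f (- x) + g (- x)) / 2 = (f x + g x) / 2" for x
      using positive_definite_even[OF pd(1)] positive_definite_even[OF pd(2)] by simp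
    fix n :: nat and w :: "nat \<Rightarrow> real" and p :: "nat \<Rightarrow> 'a"
    have "(\<Sum>i\<in>{1..n}. \<Sum>j\<in>{1..n}. w i * w j * ((f (p i - p j) + g (p i - p j)) / 2)) =
       ((\<Sum>i\<in>{1..n}. \<Sum>j\<in>{1..n}. w i * w j * f (p i - p j)) + (\<Sum>i\<in>{1..n}. \<Sum>j\<in>{1..n}. w i * w j * g (p i - p j))) / 2"
      by (simp add: sum.distrib[symmetric] sum_divide_distrib distrib_left add_divide_distrib)
    also have "\<dots> \<ge> 0" 
      by (intro divide_nonneg_pos add_nonneg_nonneg positive_definite_sum pd finite_atLeastAtMost) simp
    finally show "0 \<le> (\<Sum>i\<in>{1..n}. \<Sum>j\<in>{1..n}. w i * w j * ((f (p i - p j) + g (p i - p j)) / 2))" .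
  qed
  moreover have "continuous_on UNIV (\<lambda>x. (f x + g x) / 2)" using f g by (auto simp: GG_def P1_def intro!: continuous_intros)
  ultimately have "(\<lambda>x. (f x + g x) / 2) \<in> P1" using f g by (simp add: P1_def GG_def)
  moreover have "(f x + g x) / 2 \<le> 0" if "x \<notin> \<Omega>" for x
    using GG_nonpos[OF f that] GG_nonpos[OF g that] by simp
  ultimately show ?thesis
    using f g by (intro GG_I P1_ucont \<Omega>) (auto simp: P1_def GG_def)
qed

text \<open>Up to normalisation the form is the integral of the square of
  \<open>\<Sum>i. w i * u i y\<close>, where \<open>u i\<close> is the indicator of
  \<open>p i + V\<close>.\<close>

lemma autocorrelation_positive_definite:
  assumes V: "V \<in> sets M" "emeasure M V < \<infinity>"
  shows "positive_definite (\<lambda>x. measure M (V \<inter> {y. y - x \<in> V}) / measure M V)"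
proof (rule positive_definiteI)
  define G where "G x = measure M (V \<inter> {y. y - x \<in> V})" for x
  note tr = emeasure_vimage_translate
  have S: "V \<inter> {y. y - x \<in> V} \<in> sets M" for x using tr(1)[OF V(1)] V(1) by auto
  have shift: "measure M {y. y - a \<in> V \<inter> {y. y - x \<in> V}} = G x" for a x
    using tr(2)[OF S[of x], of a] by (simp add: G_def measure_def)
  \<comment> \<open>By invariance the overlap of two translates depends only on the difference of
    the shifts; exchanging the shifts gives evenness.\<close>
  have pair: "measure M ({y. y - a \<in> V} \<inter> {y. y - b \<in> V}) = G (a - b)" for a b
  proof -
    have "{y. y - a \<in> V} \<inter> {y. y - b \<in> V} = {y. y - b \<in> V \<inter> {y. y - (a - b) \<in> V}}" by auto
    then show ?thesis using shift[of b "a - b"] by simp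
  qed
  show "G (- x) / measure M V = G x / measure M V" for x
    using pair[of 0 x] pair[of x 0] by (simp add: Int_commute)
  fix n :: nat and w :: "nat \<Rightarrow> real" and p :: "nat \<Rightarrow> 'a"
  define u :: "nat \<Rightarrow> 'a \<Rightarrow> real" where "u i = indicator {y. y - p i \<in> V}" for i
  have uu: "u i y * u j y = indicator ({y. y - p i \<in> V} \<inter> {y. y - p j \<in> V}) y" for i j y
    by (simp add: u_def indicator_inter_arith)
  have fin: "emeasure M ({y. y - a \<in> V} \<inter> {y. y - b \<in> V}) < \<infinity>" for a b
    using emeasure_mono[of "{y. y - a \<in> V} \<inter> {y. y - b \<in> V}" "{y. y - a \<in> V}" M] tr[OF V(1)] V(2)
    by (auto intro: le_less_trans)
  have int: "integrable M (\<lambda>y. u i y * u j y)" "(\<integral>y. u i y * u j y \<partial>M) = G (p i - p j)" for i j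
    using fin[of "p i" "p j"] tr(1)[OF V(1)] pair[of "p i" "p j"]
    unfolding uu by (auto simp: integrable_indicator_iff sets.Int_space_eq2)
  have "0 \<le> (\<integral>y. (\<Sum>i\<in>{1..n}. w i * u i y)\<^sup>2 \<partial>M)" by (rule Bochner_Integration.integral_nonneg) simp
  also have "\<dots> = (\<integral>y. (\<Sum>i\<in>{1..n}. \<Sum>j\<in>{1..n}. w i * w j * (u i y * u j y)) \<partial>M)"
    by (rule Bochner_Integration.integral_cong) (auto simp: power2_eq_square sum_product mult_ac intro!: sum.cong)
  also have "\<dots> = (\<Sum>i\<in>{1..n}. \<Sum>j\<in>{1..n}. w i * w j * G (p i - p j))"
    using int by (simp add: Bochner_Integration.integral_sum)
  finally have "0 \<le> (\<Sum>i\<in>{1..n}. \<Sum>j\<in>{1..n}. w i * w j * G (p i - p j)) / measure M V"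
    by (intro divide_nonneg_nonneg) auto
  then show "0 \<le> (\<Sum>i\<in>{1..n}. \<Sum>j\<in>{1..n}. w i * w j * (G (p i - p j) / measure M V))"
    by (simp add: sum_divide_distrib)
qed

text \<open>Supplies \<open>D > 0\<close>. The normalised autocorrelation of \<open>V\<close> is
  nonnegative, equals 1 at 0, and vanishes off \<Omega> because differences of elements of
  \<open>V\<close> lie in \<Omega>.\<close>

lemma exists_GG_pos_integral:
  assumes \<Omega>: "closed \<Omega>" "0 \<in> interior \<Omega>" "emeasure M \<Omega> < \<infinity>"
  shows "\<exists>f\<in>GG M \<Omega>. 0 < (\<integral>x. f x \<partial>M)"
proof -
  have \<Omega>s: "\<Omega> \<in> sets M" using \<Omega>(1) by (simp add: sets_M)
  obtain V' where V': "open V'" "0 \<in> V'" "\<forall>x\<in>V'. \<forall>y\<in>V'. x - y \<in> interior \<Omega>"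
    using nbhd_diff[of "interior \<Omega>"] \<Omega>(2) by auto
  obtain U K where U: "open U" "(0::'a) \<in> U" "compact K" "U \<subseteq> K" by (rule compact_nbhd)
  define V where "V = V' \<inter> U"
  have V: "open V" "0 \<in> V" "\<And>x y. x \<in> V \<Longrightarrow> y \<in> V \<Longrightarrow> x - y \<in> \<Omega>"
    using V' U subsetD[OF interior_subset[of \<Omega>]] by (auto simp: V_def)
  have Vs: "V \<in> sets M" using V by (simp add: sets_M)
  have Vf: "emeasure M V < \<infinity>" by (rule test_fun_indicator(3)[OF V(1) _ U(3)]) (use U in \<open>auto simp: V_def\<close>)
  define v where "v = measure M V"
  have v: "0 < v" unfolding v_def using V(2) by (intro measure_open_pos V(1) Vf) auto
  define f where "f x = measure M (V \<inter> {y. y - x \<in> V}) / v" for x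
  have pd: "positive_definite f" unfolding f_def v_def by (rule autocorrelation_positive_definite[OF Vs Vf])
  have f0: "f 0 = 1" using v by (simp add: f_def v_def)
  have f_nonneg: "0 \<le> f x" for x using v by (simp add: f_def)
  have f_out: "f x = 0" if "x \<notin> \<Omega>" for x
  proof -
    have "V \<inter> {y. y - x \<in> V} = {}" using V(3) that by force
    then show ?thesis by (simp add: f_def)
  qed
  \<comment> \<open>A compact \<open>C\<close> exhausts \<open>V\<close> up to the fraction e. For x
    close to 0 the translate \<open>x + C\<close> still lies in \<open>V\<close>, hence in
    \<open>V \<inter> (x + V)\<close>.\<close>
  have at0: "\<exists>W. open W \<and> (0::'a) \<in> W \<and> (\<forall>x\<in>W. 1 - e \<le> f x)" if e: "0 < e" for e
  proof -
    have "ennreal ((1 - e) * v) < emeasure M V"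
      using e v Vf by (auto simp: v_def emeasure_eq_ennreal_measure algebra_simps intro!: ennreal_lessI)
    then obtain C where C: "compact C" "C \<subseteq> V" "ennreal ((1 - e) * v) < emeasure M C"
      unfolding emeasure_open_inner[OF V(1)] by (auto simp: less_SUP_iff)
    have Cs: "C \<in> sets M" using C by (simp add: sets_M compact_imp_closed)
    obtain W where W: "open W" "0 \<in> W" "\<forall>c\<in>C. \<forall>w\<in>W. w + c \<in> V"
      using compact_subset_open_translate[OF C(1) V(1) C(2)] by blast
    have "1 - e \<le> f x" if x: "x \<in> W" for x
    proof -
      have sub: "{y. y - x \<in> C} \<subseteq> V \<inter> {y. y - x \<in> V}"
      proof
        fix y assume "y \<in> {y. y - x \<in> C}"
        then have "y - x \<in> C" by simp
        moreover from this W(3) x have "x + (y - x) \<in> V" by blast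
        ultimately show "y \<in> V \<inter> {y. y - x \<in> V}" using C(2) by auto
      qed
      have S: "V \<inter> {y. y - x \<in> V} \<in> sets M" using emeasure_vimage_translate(1)[OF Vs] Vs by auto
      have "ennreal ((1 - e) * v) \<le> emeasure M {y. y - x \<in> C}"
        using C(3) emeasure_vimage_translate(2)[OF Cs, of x] by simp
      also have "\<dots> \<le> emeasure M (V \<inter> {y. y - x \<in> V})" by (rule emeasure_mono[OF sub S])
      also have "\<dots> = ennreal (measure M (V \<inter> {y. y - x \<in> V}))"
        using emeasure_mono[of "V \<inter> {y. y - x \<in> V}" V M] Vs Vf by (intro emeasure_eq_ennreal_measure) (auto simp: top_unique)
      finally have "(1 - e) * v \<le> measure M (V \<inter> {y. y - x \<in> V})" by simp
      then show ?thesis using v by (simp add: f_def field_simps)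
    qed
    with W show ?thesis by blast
  qed
  have uc: "ucont f" by (rule positive_definite_ucont[OF pd f0 at0])
  note le1 = positive_definite_abs_le_1[OF pd f0]
  have int: "integrable M f"
  proof (rule Bochner_Integration.integrable_bound[of M "indicator \<Omega> :: 'a \<Rightarrow> real"])
    show "integrable M (indicator \<Omega> :: 'a \<Rightarrow> real)" using \<Omega>s \<Omega>(3) by (simp add: integrable_indicator_iff)
    show "f \<in> borel_measurable M" by (intro measurable_continuous ucont_continuous uc)
    show "AE x in M. norm (f x) \<le> norm (indicator \<Omega> x :: real)"
      using le1 f_out by (auto simp: indicator_def)
  qed
  obtain W where W: "open W" "0 \<in> W" "\<And>x. x \<in> W \<Longrightarrow> 1 - 1/2 \<le> f x" using at0[of "1/2"] by auto
  have W\<Omega>: "W \<subseteq> \<Omega>" using W(3) f_out by force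
  have Ws: "W \<in> sets M" using W by (simp add: sets_M)
  have Wf: "emeasure M W < \<infinity>" using emeasure_mono[OF W\<Omega> \<Omega>s] \<Omega>(3) by (rule le_less_trans)
  have "0 < measure M W" using W(2) by (intro measure_open_pos W(1) Wf) auto
  then have "0 < 1/2 * measure M W" by simp
  also have "\<dots> = (\<integral>x. 1/2 * indicator W x \<partial>M)" using Ws by (simp add: sets.Int_space_eq2)
  also have "\<dots> \<le> (\<integral>x. f x \<partial>M)"
  proof (rule integral_mono[OF _ int])
    show "integrable M (\<lambda>x. 1/2 * indicator W x :: real)" using Ws Wf by (intro integrable_mult_right) (simp add: integrable_indicator_iff)
    show "1/2 * indicator W x \<le> f x" for x using W(3)[of x] f_nonneg[of x] by (auto simp: indicator_def)
  qed
  finally have "0 < (\<integral>x. f x \<partial>M)" .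
  moreover have "f \<in> GG M \<Omega>" using f_out by (intro GG_I uc pd f0 int \<Omega>(1)) simp
  ultimately show ?thesis by blast
qed

text \<open>The second bound integrates
  \<open>\<bar>f\<bar> \<le> 2 * indicator \<Omega> - f\<close>, which holds on \<Omega> because
  \<open>\<bar>f\<bar> \<le> 1\<close> and off \<Omega> because there
  \<open>\<bar>f\<bar> = - f\<close>.\<close>

lemma GG_integral_bounds:
  assumes f: "f \<in> GG M \<Omega>" and \<Omega>: "closed \<Omega>" "emeasure M \<Omega> < \<infinity>"
  shows "(\<integral>x. f x \<partial>M) \<le> measure M \<Omega>"
    and "(\<integral>x. \<bar>f x\<bar> \<partial>M) \<le> 2 * measure M \<Omega> - (\<integral>x. f x \<partial>M)"
    and "(\<integral>x. (f x)\<^sup>2 \<partial>M) \<le> (\<integral>x. \<bar>f x\<bar> \<partial>M)"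
    and "integrable M (\<lambda>x. (f x)\<^sup>2)"
proof -
  have f': "f \<in> P1" "integrable M f" "positive_definite f" "f 0 = 1" using f by (auto simp: GG_def P1_def)
  have i: "integrable M (indicator \<Omega> :: 'a \<Rightarrow> real)" using \<Omega> by (simp add: integrable_indicator_iff sets_M)
  have I: "(\<integral>x. indicator \<Omega> x \<partial>M) = measure M \<Omega>" using \<Omega> by (simp add: sets_M)
  note le1 = positive_definite_abs_le_1[OF f'(3,4)]
  have le: "f x \<le> indicator \<Omega> x" "\<bar>f x\<bar> \<le> 2 * indicator \<Omega> x - f x" for x
    using le1[of x] GG_nonpos[OF f, of x] by (auto simp: indicator_def)
  show "(\<integral>x. f x \<partial>M) \<le> measure M \<Omega>"
    using integral_mono[OF f'(2) i le(1)] I by simp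
  show "(\<integral>x. \<bar>f x\<bar> \<partial>M) \<le> 2 * measure M \<Omega> - (\<integral>x. f x \<partial>M)"
    using integral_mono[OF integrable_abs[OF f'(2)] Bochner_Integration.integrable_diff[OF integrable_mult_right[OF i, of 2] f'(2)] le(2)]
      f'(2) i I by simp
  show sq: "integrable M (\<lambda>x. (f x)\<^sup>2)"
    unfolding power2_eq_square using f'(1)
    by (intro integrable_mult_bounded[OF _ le1] measurable_continuous f'(2)) (simp add: P1_def)
  show "(\<integral>x. (f x)\<^sup>2 \<partial>M) \<le> (\<integral>x. \<bar>f x\<bar> \<partial>M)"
  proof (rule integral_mono[OF sq integrable_abs[OF f'(2)]])
    show "(f x)\<^sup>2 \<le> \<bar>f x\<bar>" for x
      using mult_left_le[OF le1[of x] abs_ge_zero[of "f x"]] by (simp add: power2_eq_square)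
  qed
qed

lemma exists_extremal:
  assumes \<Omega>: "closed \<Omega>" "0 \<in> interior \<Omega>" "emeasure M \<Omega> < \<infinity>"
  shows "\<exists>f\<in>GG M \<Omega>. ereal (\<integral>x. f x \<partial>M) = DD M \<Omega>"
proof -
  have \<Omega>s: "\<Omega> \<in> sets M" using \<Omega>(1) by (simp add: sets_M)
  obtain f0 where f0: "f0 \<in> GG M \<Omega>" "0 < (\<integral>x. f0 x \<partial>M)" using exists_GG_pos_integral[OF \<Omega>] by blast
  have "DD M \<Omega> \<le> ereal (measure M \<Omega>)"
    unfolding DD_def using GG_integral_bounds(1)[OF _ \<Omega>(1,3)] by (intro SUP_least) auto
  moreover have upper: "ereal (\<integral>x. f x \<partial>M) \<le> DD M \<Omega>" if "f \<in> GG M \<Omega>" for f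
    unfolding DD_def by (rule SUP_upper[OF that])
  ultimately obtain D where D: "DD M \<Omega> = ereal D"
    using upper[OF f0(1)] by (cases "DD M \<Omega>") auto
  have leD: "(\<integral>x. f x \<partial>M) \<le> D" if "f \<in> GG M \<Omega>" for f using upper[OF that] D by simp
  have Dpos: "0 < D" using leD[OF f0(1)] f0(2) by linarith
  define K where "K n = {f \<in> GG M \<Omega>. D - 1 / real (Suc n) \<le> (\<integral>x. f x \<partial>M)}" for n
  \<comment> \<open>The L^1 bound for functions with integral at least \<open>D - 1\<close>, which
    covers every \<open>K n\<close>.\<close>
  define C where "C = 2 * measure M \<Omega> - D + 1"
  have KC: "(\<integral>x. \<bar>f x\<bar> \<partial>M) \<le> C" if "f \<in> K n" for f n
  proof -
    have "D - 1 / real (Suc n) \<le> (\<integral>x. f x \<partial>M)" "f \<in> GG M \<Omega>" using that by (auto simp: K_def)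
    moreover have "1 / real (Suc n) \<le> 1" by simp
    ultimately show ?thesis using GG_integral_bounds(2)[OF _ \<Omega>(1,3), of f] unfolding C_def by linarith
  qed
  have ne: "\<exists>f. f \<in> K n" for n
  proof -
    have "ereal (D - 1 / real (Suc n)) < DD M \<Omega>" by (simp add: D)
    then obtain f where "f \<in> GG M \<Omega>" "ereal (D - 1 / real (Suc n)) < ereal (\<integral>x. f x \<partial>M)"
      unfolding DD_def less_SUP_iff by blast
    then show ?thesis by (intro exI[of _ f]) (simp add: K_def)
  qed
  have "\<exists>g. (\<forall>n. g n \<in> K n) \<and> (\<forall>e>0. \<exists>N. \<forall>m\<ge>N. \<forall>n\<ge>N. (\<integral>x. (g m x - g n x)\<^sup>2 \<partial>M) < e)"
  proof (rule minimizing_sequence_Cauchy[of K "\<lambda>f. \<integral>x. (f x)\<^sup>2 \<partial>M" C "\<lambda>f g. \<integral>x. (f x - g x)\<^sup>2 \<partial>M"])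
    show "0 \<le> (\<integral>x. (f x)\<^sup>2 \<partial>M)" for f :: "'a \<Rightarrow> real" by (rule Bochner_Integration.integral_nonneg) simp
    show "\<exists>f\<in>K n. (\<integral>x. (f x)\<^sup>2 \<partial>M) \<le> C" for n
    proof -
      obtain f where f: "f \<in> K n" using ne by blast
      then have "f \<in> GG M \<Omega>" by (simp add: K_def)
      from GG_integral_bounds(3)[OF this \<Omega>(1,3)] KC[OF f] f show ?thesis by force
    qed
    show "K n \<subseteq> K m" if "m \<le> n" for m n
      using frac_le[of 1 1 "real (Suc m)" "real (Suc n)"] that by (auto simp: K_def)
    fix n f g assume fg: "f \<in> K n" "g \<in> K n"
    then have G: "f \<in> GG M \<Omega>" "g \<in> GG M \<Omega>" by (auto simp: K_def)
    note i = G[unfolded GG_def, simplified, THEN conjunct2, THEN conjunct1]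
    note sq = GG_integral_bounds(4)[OF G(1) \<Omega>(1,3)] GG_integral_bounds(4)[OF G(2) \<Omega>(1,3)]
    have prod: "integrable M (\<lambda>x. f x * g x)" using i sq by (intro integral_Cauchy_Schwarz(1)) auto
    show "\<exists>c\<in>K n. (\<integral>x. (f x - g x)\<^sup>2 \<partial>M) \<le> 2 * (\<integral>x. (f x)\<^sup>2 \<partial>M) + 2 * (\<integral>x. (g x)\<^sup>2 \<partial>M) - 4 * (\<integral>x. (c x)\<^sup>2 \<partial>M)"
    proof (rule bexI)
      have "(f x - g x)\<^sup>2 = 2 * (f x)\<^sup>2 + 2 * (g x)\<^sup>2 - 4 * ((f x + g x) / 2)\<^sup>2" for x
        by (simp add: power2_eq_square field_simps)
      moreover have "integrable M (\<lambda>x. ((f x + g x) / 2)\<^sup>2)"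
        by (rule GG_integral_bounds(4)[OF GG_midpoint[OF G \<Omega>(1)] \<Omega>(1,3)])
      ultimately show "(\<integral>x. (f x - g x)\<^sup>2 \<partial>M) \<le> 2 * (\<integral>x. (f x)\<^sup>2 \<partial>M) + 2 * (\<integral>x. (g x)\<^sup>2 \<partial>M) - 4 * (\<integral>x. ((f x + g x) / 2)\<^sup>2 \<partial>M)"
        using sq by simp
      have "(\<integral>x. (f x + g x) / 2 \<partial>M) = ((\<integral>x. f x \<partial>M) + (\<integral>x. g x \<partial>M)) / 2" using i by simp
      then show "(\<lambda>x. (f x + g x) / 2) \<in> K n" using GG_midpoint[OF G \<Omega>(1)] fg by (simp add: K_def)
    qed
  qed
  then obtain g where gK: "\<And>n. g n \<in> K n"
    and gC: "\<And>e. 0 < e \<Longrightarrow> \<exists>N. \<forall>m\<ge>N. \<forall>n\<ge>N. (\<integral>x. (g m x - g n x)\<^sup>2 \<partial>M) < e" by blast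
  have g: "g n \<in> GG M \<Omega>" "D - 1 / real (Suc n) \<le> (\<integral>x. g n x \<partial>M)" for n using gK[of n] by (auto simp: K_def)
  interpret pd_L2_Cauchy M g
    by unfold_locales (use g gC in \<open>auto simp: GG_def\<close>)
  obtain h where h: "ucont h" "\<And>x. \<bar>h x\<bar> \<le> 1"
    "\<And>A. A \<in> sets M \<Longrightarrow> emeasure M A < \<infinity> \<Longrightarrow> (\<lambda>k. \<integral>x. indicator A x * \<bar>g k x - h x\<bar> \<partial>M) \<longlonglongrightarrow> 0"
    using exists_L1_limit by blast
  have hpd: "positive_definite h" by (rule L1_limit_positive_definite[OF h])
  have hi: "integrable M h" by (rule L1_limit_integrable[OF h KC[OF gK]])
  have hn: "h x \<le> 0" if "x \<notin> \<Omega>" for x by (rule L1_limit_nonpos[OF h \<Omega>(1) GG_nonpos[OF g(1)] that])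
  have hD: "D \<le> (\<integral>x. h x \<partial>M)" by (rule L1_limit_integral_ge[OF h KC[OF gK] \<Omega>s \<Omega>(3) GG_nonpos[OF g(1)] g(2)])
  \<comment> \<open>As \<open>h 0\<close> dominates \<open>\<bar>h x\<bar>\<close>, its vanishing
    would make \<open>h\<close> identically 0, against \<open>0 < D\<close>.\<close>
  have h0: "0 < h 0"
  proof (rule ccontr)
    assume "\<not> 0 < h 0"
    then have "h x = 0" for x using positive_definite_abs_le[OF hpd, of x] by simp
    then have "(\<integral>x. h x \<partial>M) = 0" by simp
    with hD Dpos show False by simp
  qed
  have "(\<lambda>x. h x / h 0) \<in> GG M \<Omega>"
  proof (rule GG_I[OF _ _ _ _ \<Omega>(1)])
    show pd': "positive_definite (\<lambda>x. h x / h 0)"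
    proof (rule positive_definiteI)
      show "h (- x) / h 0 = h x / h 0" for x by (simp add: positive_definite_even[OF hpd])
      fix n :: nat and w :: "nat \<Rightarrow> real" and p :: "nat \<Rightarrow> 'a"
      have "0 \<le> (\<Sum>i\<in>{1..n}. \<Sum>j\<in>{1..n}. w i * w j * h (p i - p j)) / h 0"
        using h0 by (intro divide_nonneg_pos positive_definite_sum hpd) auto
      then show "0 \<le> (\<Sum>i\<in>{1..n}. \<Sum>j\<in>{1..n}. w i * w j * (h (p i - p j) / h 0))"
        by (simp add: sum_divide_distrib)
    qed
    show "h 0 / h 0 = 1" using h0 by simp
    have "continuous_on UNIV (\<lambda>x. h x / h 0)"
      using ucont_continuous[OF h(1)] h0 by (intro continuous_on_divide continuous_on_const) auto
    with pd' h0 show "ucont (\<lambda>x. h x / h 0)" by (intro P1_ucont) (simp add: P1_def)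
    show "h x / h 0 \<le> 0" if "x \<notin> \<Omega>" for x using hn[OF that] h0 by (simp add: divide_nonpos_pos)
  qed (use hi in simp)
  \<comment> \<open>Maximality of \<open>D\<close>, applied to the rescaled function, closes the
    chain \<open>D \<le> \<integral>h \<le> D * h 0\<close>, which together with
    \<open>h 0 \<le> 1\<close> forces the normalisation.\<close>
  from leD[OF this] have "(\<integral>x. h x \<partial>M) \<le> D * h 0" using h0 by (simp add: field_simps)
  with hD have "D * 1 \<le> D * h 0" by simp
  then have "1 \<le> h 0" using Dpos by simp
  with h(2)[of 0] have "h 0 = 1" by simp
  then have hG: "h \<in> GG M \<Omega>" by (intro GG_I h(1) hpd hi \<Omega>(1) hn)
  with leD[OF hG] hD D show ?thesis by (intro bexI[of _ h]) auto
qed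

end

theorem theorem9:
  fixes M :: "'a::{ab_group_add, t2_space} measure" and \<Omega> :: "'a set"
  assumes "lca_group TYPE('a)"
    and "haar_measure M"
    and "closed \<Omega>" and "0 \<in> interior \<Omega>"
    and "emeasure M \<Omega> < \<infinity>"
  shows "\<exists>f \<in> GG M \<Omega>. ereal (integral\<^sup>L M f) = DD M \<Omega> \<and>
           (\<exists>fs :: nat \<Rightarrow> 'a \<Rightarrow> real. (\<forall>n. fs n \<in> GG M \<Omega>) \<and>
              (\<lambda>n. ereal (integral\<^sup>L M (fs n))) \<longlonglongrightarrow> DD M \<Omega> \<and>
              (\<forall>K. compact K \<longrightarrow> uniform_limit K fs f sequentially))"
proof -
  interpret haar_group M by unfold_locales (rule assms)+
  obtain f where f: "f \<in> GG M \<Omega>" "ereal (\<integral>x. f x \<partial>M) = DD M \<Omega>"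
    using exists_extremal[OF assms(3-5)] by blast
  \<comment> \<open>Since f attains the supremum, the constant sequence f is maximising and
    converges uniformly everywhere.\<close>
  show ?thesis
  proof (intro bexI[OF _ f(1)] conjI exI[of _ "\<lambda>_. f"] allI impI)
    show "(\<lambda>n. ereal (\<integral>x. f x \<partial>M)) \<longlonglongrightarrow> DD M \<Omega>" by (simp add: f(2))
    show "uniform_limit K (\<lambda>_. f) f sequentially" for K by (auto intro: uniform_limitI)
  qed (use f in auto)
qed

end
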